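(* Let $1\le p\le\infty$, $\xi\in L^p(\mathbb T^2)\cap\mathcal E$ and $\tau>0$. If the equation $$\Phi_\tau(\xi)=\xi-\tau(K*\xi)\cdot\nabla\Phi_\tau(\xi)$$ has a strong solution $\Phi_\tau(\xi)$, then $$|\Phi_\tau(\xi)|_p\le|\xi|_p.$$
   Context: $\mathbb T^2=\mathbb R^2/\mathbb Z^2$; $|\cdot|_p$ is the $L^p(\mathbb T^2)$-norm; $\mathcal E$ is the space of square integrable periodic functions on $\mathbb T^2$ with zero mean. For $\xi\in\mathcal E$, $K*\xi$ ($K$ the Biot–Savart kernel on $\mathbb T^2$) denotes the unique zero-mean divergence free vector field $u$ on $\mathbb T^2$ with $\nabla^\perp\cdot u=\partial_1u_2-\partial_2u_1=\xi$. A strong solution is an element of $W^{1,4}(\mathbb T^2)\cap\mathcal E$ satisfying the equation almost everywhere on $\mathbb T^2$. *)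

theory Defs
  imports "HOL-Analysis.Analysis" "HOL-Probability.Essential_Supremum"
begin

text \<open>
  Functions on the torus \<open>\<real>\<^sup>2/\<int>\<^sup>2\<close> are represented by \<open>\<int>\<^sup>2\<close>-periodic functions on the plane, and
  integration over the torus is Lebesgue integration over the unit square, a fundamental domain.
\<close>

definition Z2_periodic :: "(real^2 \<Rightarrow> 'b) \<Rightarrow> bool" where
  "Z2_periodic f \<longleftrightarrow> (\<forall>x i. f (x + axis i 1) = f x)"

definition torus :: "(real^2) measure" where
  "torus = lebesgue_on (cbox 0 One)"

text \<open>For finite \<open>p\<close> the norm is \<open>(\<integral>|f|\<^sup>p)\<^sup>1\<^sup>/\<^sup>p\<close>, computed in \<^typ>\<open>ennreal\<close> so that it is \<open>\<infinity>\<close>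
  (and not a default value) whenever the integral diverges.\<close>

definition Lp_norm :: "ennreal \<Rightarrow> (real^2 \<Rightarrow> real) \<Rightarrow> ennreal" where
  "Lp_norm p f =
    (if p = \<infinity> then esssup torus (\<lambda>x. ennreal \<bar>f x\<bar>)
     else let I = (\<integral>\<^sup>+ x. ennreal (\<bar>f x\<bar> powr enn2real p) \<partial>torus)
          in if I = \<infinity> then \<infinity> else ennreal (enn2real I powr (1 / enn2real p)))"

definition Lp_space :: "ennreal \<Rightarrow> (real^2 \<Rightarrow> real) set" where
  "Lp_space p = {f. Z2_periodic f \<and> f \<in> borel_measurable torus \<and> Lp_norm p f < \<infinity>}"

text \<open>The space \<open>\<E>\<close>.\<close>

definition zero_mean_L2 :: "(real^2 \<Rightarrow> real) set" where
  "zero_mean_L2 = {f \<in> Lp_space 2. (\<integral>x. f x \<partial>torus) = 0}"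

definition partial :: "2 \<Rightarrow> (real^2 \<Rightarrow> real) \<Rightarrow> real^2 \<Rightarrow> real" where
  "partial i f x = frechet_derivative f (at x) (axis i 1)"

primrec Ck :: "nat \<Rightarrow> (real^2 \<Rightarrow> real) \<Rightarrow> bool" where
  "Ck 0 f \<longleftrightarrow> continuous_on UNIV f"
| "Ck (Suc k) f \<longleftrightarrow> (\<forall>x. f differentiable (at x)) \<and> (\<forall>i. Ck k (partial i f))"

definition test_functions :: "(real^2 \<Rightarrow> real) set" where
  "test_functions = {\<psi>. Z2_periodic \<psi> \<and> (\<forall>k. Ck k \<psi>)}"

text \<open>Derivatives are taken in the sense of distributions on the torus. No compact support is
  required of the test functions, since the torus is compact without boundary.\<close>

definition has_weak_gradient :: "(real^2 \<Rightarrow> real) \<Rightarrow> (real^2 \<Rightarrow> real^2) \<Rightarrow> bool" where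
  "has_weak_gradient f G \<longleftrightarrow>
     f \<in> Lp_space 1 \<and>
     (\<forall>i. (\<lambda>x. G x $ i) \<in> Lp_space 1 \<and>
          (\<forall>\<psi>\<in>test_functions.
             (\<integral>x. f x * partial i \<psi> x \<partial>torus) = - (\<integral>x. G x $ i * \<psi> x \<partial>torus)))"

definition sobolev_W1 :: "ennreal \<Rightarrow> (real^2 \<Rightarrow> real) set" where
  "sobolev_W1 p = {f \<in> Lp_space p.
     \<exists>G. has_weak_gradient f G \<and> (\<forall>i. (\<lambda>x. G x $ i) \<in> Lp_space p)}"

definition weakly_divergence_free :: "(real^2 \<Rightarrow> real^2) \<Rightarrow> bool" where
  "weakly_divergence_free u \<longleftrightarrow>
     (\<forall>\<psi>\<in>test_functions.
        (\<integral>x. u x $ 1 * partial 1 \<psi> x + u x $ 2 * partial 2 \<psi> x \<partial>torus) = 0)"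

text \<open>\<open>\<partial>\<^sub>1u\<^sub>2 - \<partial>\<^sub>2u\<^sub>1 = \<xi>\<close>\<close>

definition has_weak_curl :: "(real^2 \<Rightarrow> real^2) \<Rightarrow> (real^2 \<Rightarrow> real) \<Rightarrow> bool" where
  "has_weak_curl u \<xi> \<longleftrightarrow>
     (\<forall>\<psi>\<in>test_functions.
        (\<integral>x. u x $ 2 * partial 1 \<psi> x - u x $ 1 * partial 2 \<psi> x \<partial>torus)
          = - (\<integral>x. \<xi> x * \<psi> x \<partial>torus))"

text \<open>\<open>u = K * \<xi>\<close>. This is a relation and not a function because the field is determined by \<open>\<xi>\<close>
  only up to null sets.\<close>

definition is_biot_savart :: "(real^2 \<Rightarrow> real) \<Rightarrow> (real^2 \<Rightarrow> real^2) \<Rightarrow> bool" where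
  "is_biot_savart \<xi> u \<longleftrightarrow>
     (\<forall>i. (\<lambda>x. u x $ i) \<in> zero_mean_L2) \<and> weakly_divergence_free u \<and> has_weak_curl u \<xi>"

text \<open>\<open>\<phi>\<close> is a strong solution of \<open>\<phi> = \<xi> - \<tau> (K * \<xi>) \<cdot> \<nabla>\<phi>\<close>. Both \<open>K * \<xi>\<close> and the weak gradient are
  unique up to null sets, so the existential quantifier only chooses representatives.\<close>

definition strong_solution :: "real \<Rightarrow> (real^2 \<Rightarrow> real) \<Rightarrow> (real^2 \<Rightarrow> real) \<Rightarrow> bool" where
  "strong_solution \<tau> \<xi> \<phi> \<longleftrightarrow>
     \<phi> \<in> sobolev_W1 4 \<inter> zero_mean_L2 \<and>
     (\<exists>u G. is_biot_savart \<xi> u \<and> has_weak_gradient \<phi> G \<and>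
            (AE x in torus. \<phi> x = \<xi> x - \<tau> * (u x \<bullet> G x)))"

end

theory Submission
  imports Defs "HOL-Probability.Levy"
begin

text \<open>
  Put \<open>h = \<phi> - \<xi> = - \<tau> u \<cdot> \<nabla>\<phi>\<close> almost everywhere. Since \<open>u\<close> is divergence free, \<open>h\<close> is orthogonal to every smooth
  function of \<open>\<phi>\<close>: \<open>\<integral> u \<cdot> \<nabla>\<phi> B'(\<phi>) = \<integral> u \<cdot> \<nabla>(B \<circ> \<phi>) = 0\<close>. For \<open>B\<close> a sinusoid this is obtained by
  replacing \<open>\<phi>\<close> by its partial sums in the real orthonormal basis \<open>cos (2\<pi>k\<cdot>x) + sin (2\<pi>k\<cdot>x)\<close>, which converge
  in \<open>L\<^sup>2\<close> together with their gradients because \<open>\<nabla>\<phi>\<close> is in \<open>L\<^sup>4\<close> and hence in \<open>L\<^sup>2\<close>. By uniqueness of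
  characteristic functions, \<open>h\<close> is then orthogonal to all bounded Borel functions of \<open>\<phi>\<close>, so that \<open>\<phi>\<close> is the conditional expectation of \<open>\<xi>\<close> given \<open>\<phi>\<close>. The estimate is Jensen's inequality,
  with the tangent of \<open>\<bar>s\<bar>\<^sup>p\<close> as bounded Borel function on \<open>{\<bar>\<phi>\<bar> \<le> n}\<close>, and for \<open>p = \<infinity>\<close> with indicator functions.
\<close>

section \<open>Square integrable functions\<close>

definition square_integrable :: "'a measure \<Rightarrow> ('a \<Rightarrow> real) \<Rightarrow> bool" where
  "square_integrable M f \<longleftrightarrow> f \<in> borel_measurable M \<and> integrable M (\<lambda>x. (f x)\<^sup>2)"

lemma square_integrable_power2:
  "square_integrable M f \<Longrightarrow> integrable M (\<lambda>x. (f x)\<^sup>2)"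
  by (simp add: square_integrable_def)

lemma square_integrable_mult_integrable:
  assumes "square_integrable M f" "square_integrable M g"
  shows "integrable M (\<lambda>x. f x * g x)"
proof (rule Bochner_Integration.integrable_bound)
  show "integrable M (\<lambda>x. (f x)\<^sup>2 + (g x)\<^sup>2)"
    using assms by (simp add: square_integrable_def)
  have [measurable]: "f \<in> borel_measurable M" "g \<in> borel_measurable M"
    using assms by (simp_all add: square_integrable_def)
  show "(\<lambda>x. f x * g x) \<in> borel_measurable M"
    by measurable
  have "\<bar>a * b\<bar> \<le> a\<^sup>2 + b\<^sup>2" for a b :: real
    using sum_squares_bound[of "\<bar>a\<bar>" "\<bar>b\<bar>"] mult_nonneg_nonneg[of "\<bar>a\<bar>" "\<bar>b\<bar>"]
    by (simp only: abs_mult power2_abs mult.assoc) linarith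
  then show "AE x in M. norm (f x * g x) \<le> norm ((f x)\<^sup>2 + (g x)\<^sup>2)"
    by simp
qed

lemma square_integrable_add:
  assumes "square_integrable M f" "square_integrable M g"
  shows "square_integrable M (\<lambda>x. f x + g x)"
  using assms square_integrable_mult_integrable[OF assms]
  by (auto simp: square_integrable_def power2_sum mult.assoc)

lemma square_integrable_cmult:
  "square_integrable M f \<Longrightarrow> square_integrable M (\<lambda>x. c * f x)"
  by (auto simp: square_integrable_def power_mult_distrib)

lemma square_integrable_diff:
  assumes "square_integrable M f" "square_integrable M g"
  shows "square_integrable M (\<lambda>x. f x - g x)"
  using square_integrable_add[OF assms(1) square_integrable_cmult[OF assms(2), of "- 1"]] by simp

lemma square_integrable_bounded:
  assumes "finite_measure M" "f \<in> borel_measurable M" "\<And>x. x \<in> space M \<Longrightarrow> \<bar>f x\<bar> \<le> C"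
  shows "square_integrable M f"
  unfolding square_integrable_def
proof
  show "integrable M (\<lambda>x. (f x)\<^sup>2)"
  proof (rule finite_measure.integrable_const_bound[OF assms(1)])
    have "\<bar>(f x)\<^sup>2\<bar> \<le> C\<^sup>2" if "x \<in> space M" for x
      using power_mono[OF assms(3)[OF that] abs_ge_zero, of 2] by simp
    then show "AE x in M. norm ((f x)\<^sup>2) \<le> C\<^sup>2" by (auto intro: AE_I2)
  qed (use assms in measurable)
qed fact

lemma square_integrable_mult_bounded:
  assumes f: "square_integrable M f" and b: "b \<in> borel_measurable M" "\<And>x. \<bar>b x\<bar> \<le> 1"
  shows "square_integrable M (\<lambda>x. b x * f x)"
  unfolding square_integrable_def
proof
  have [measurable]: "f \<in> borel_measurable M" "b \<in> borel_measurable M"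
    using assms by (simp_all add: square_integrable_def)
  show "(\<lambda>x. b x * f x) \<in> borel_measurable M" by measurable
  show "integrable M (\<lambda>x. (b x * f x)\<^sup>2)"
  proof (rule Bochner_Integration.integrable_bound[OF square_integrable_power2[OF f]])
    have "(b x)\<^sup>2 \<le> 1" for x
      using power_mono[OF b(2) abs_ge_zero, of x 2] by simp
    then show "AE x in M. norm ((b x * f x)\<^sup>2) \<le> norm ((f x)\<^sup>2)"
      by (simp add: power_mult_distrib mult_left_le_one_le)
  qed measurable
qed

lemma square_integrable_imp_integrable:
  assumes "finite_measure M" "square_integrable M f"
  shows "integrable M f"
  using square_integrable_mult_integrable[OF assms(2) square_integrable_bounded[OF assms(1), of "\<lambda>x. 1" 1]]
  by simp

lemma integrable_mult_bounded:
  fixes f b :: "'a \<Rightarrow> real"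
  assumes f: "integrable M f" and b: "b \<in> borel_measurable M" "\<And>x. \<bar>b x\<bar> \<le> C"
  shows "integrable M (\<lambda>x. f x * b x)"
proof (rule Bochner_Integration.integrable_bound)
  show "integrable M (\<lambda>x. C * f x)" using f by simp
  show "AE x in M. norm (f x * b x) \<le> norm (C * f x)"
  proof (rule AE_I2)
    fix x
    have "\<bar>f x\<bar> * \<bar>b x\<bar> \<le> \<bar>f x\<bar> * \<bar>C\<bar>"
      using b(2)[of x] by (intro mult_left_mono) auto
    then show "norm (f x * b x) \<le> norm (C * f x)" by (simp add: abs_mult mult.commute)
  qed
qed (use f b in measurable)

text \<open>Nonnegativity of the integral of \<open>(f x + s * g x)\<^sup>2\<close> for every real
  \<open>s\<close> forces the discriminant of this quadratic in \<open>s\<close> to be at most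
  zero.\<close>

lemma Cauchy_Schwarz_integral:
  assumes f: "square_integrable M f" and g: "square_integrable M g"
  shows "(\<integral>x. f x * g x \<partial>M)\<^sup>2 \<le> (\<integral>x. (f x)\<^sup>2 \<partial>M) * (\<integral>x. (g x)\<^sup>2 \<partial>M)"
proof -
  define A B C where "A = (\<integral>x. (f x)\<^sup>2 \<partial>M)" and "B = (\<integral>x. f x * g x \<partial>M)" and "C = (\<integral>x. (g x)\<^sup>2 \<partial>M)"
  have *: "0 \<le> A + 2 * s * B + s\<^sup>2 * C" for s
  proof -
    have "0 \<le> (\<integral>x. (f x + s * g x)\<^sup>2 \<partial>M)" by simp
    also have "\<dots> = (\<integral>x. (f x)\<^sup>2 + 2 * s * (f x * g x) + s\<^sup>2 * (g x)\<^sup>2 \<partial>M)"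
      by (simp add: power2_sum power_mult_distrib mult_ac add_ac)
    also have "\<dots> = A + 2 * s * B + s\<^sup>2 * C"
      unfolding A_def B_def C_def
      using square_integrable_power2[OF f] square_integrable_power2[OF g]
        square_integrable_mult_integrable[OF f g] by simp
    finally show ?thesis .
  qed
  have "C \<ge> 0" by (simp add: C_def)
  show ?thesis
  proof (cases "C = 0")
    case True
    \<comment> \<open>With \<open>C = 0\<close> the expression in \<open>*\<close> is affine in
      \<open>s\<close>; if \<open>B\<close> were nonzero, the chosen \<open>s\<close> would give it
      the value -1.\<close>
    then have "B = 0"
      using *[of "- (A + 1) / (2 * B)"] by (cases "B = 0") (auto simp: field_simps)
    then show ?thesis using True by (simp add: A_def B_def C_def)
  next
    case False
    then have "C > 0" using \<open>C \<ge> 0\<close> by simp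
    \<comment> \<open>\<open>- B / C\<close> minimises the quadratic; the factor \<open>C\<close>
      clears the denominators.\<close>
    have "0 \<le> (A + 2 * (- B / C) * B + (- B / C)\<^sup>2 * C) * C"
      using * \<open>C \<ge> 0\<close> by (intro mult_nonneg_nonneg)
    also have "\<dots> = A * C - B\<^sup>2"
      using \<open>C > 0\<close> by (simp add: field_simps power2_eq_square)
    finally show ?thesis by (simp add: A_def B_def C_def)
  qed
qed

text \<open>Cauchy-Schwarz, with the multipliers absorbed into \<open>g n\<close> since they are
  bounded by 1. They may vary with \<open>n\<close>: later they are cosines of partial sums.\<close>

lemma integral_mult_tendsto_zero:
  assumes f: "square_integrable M f" and g: "\<And>n. square_integrable M (g n)"
    and lim: "(\<lambda>n. \<integral>x. (g n x)\<^sup>2 \<partial>M) \<longlonglongrightarrow> 0"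
    and b: "\<And>n. b n \<in> borel_measurable M" "\<And>n x. \<bar>b n x\<bar> \<le> 1"
  shows "(\<lambda>n. \<integral>x. f x * (b n x * g n x) \<partial>M) \<longlonglongrightarrow> 0"
proof -
  have le: "(\<integral>x. f x * (b n x * g n x) \<partial>M)\<^sup>2 \<le> (\<integral>x. (f x)\<^sup>2 \<partial>M) * (\<integral>x. (g n x)\<^sup>2 \<partial>M)" for n
  proof -
    have sq: "square_integrable M (\<lambda>x. b n x * g n x)"
      by (rule square_integrable_mult_bounded[OF g b])
    have "(b n x)\<^sup>2 \<le> 1" for x
      using power_mono[OF b(2) abs_ge_zero, of n x 2] by simp
    then have "(\<integral>x. (b n x * g n x)\<^sup>2 \<partial>M) \<le> (\<integral>x. (g n x)\<^sup>2 \<partial>M)"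
      by (intro integral_mono square_integrable_power2 sq g)
         (simp add: power_mult_distrib mult_left_le_one_le)
    then show ?thesis
      by (intro order_trans[OF Cauchy_Schwarz_integral[OF f sq]] mult_left_mono) auto
  qed
  have "(\<lambda>n. (\<integral>x. f x * (b n x * g n x) \<partial>M)\<^sup>2) \<longlonglongrightarrow> 0"
  proof (rule tendsto_sandwich[OF _ _ tendsto_const])
    show "(\<lambda>n. (\<integral>x. (f x)\<^sup>2 \<partial>M) * (\<integral>x. (g n x)\<^sup>2 \<partial>M)) \<longlonglongrightarrow> 0"
      using tendsto_mult_right_zero[OF lim] .
  qed (use le in auto)
  then show ?thesis by (simp add: power_tendsto_0_iff)
qed

text \<open>On a finite measure space convergence in L2 implies convergence in L1, and the latter
  gives an almost everywhere convergent subsequence.\<close>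

lemma tendsto_L2_AE_subseq:
  assumes M: "finite_measure M" and g: "\<And>n. square_integrable M (g n)"
    and lim: "(\<lambda>n. \<integral>x. (g n x)\<^sup>2 \<partial>M) \<longlonglongrightarrow> 0"
  shows "\<exists>r::nat \<Rightarrow> nat. strict_mono r \<and> (AE x in M. (\<lambda>n. g (r n) x) \<longlonglongrightarrow> 0)"
proof (rule tendsto_L1_AE_subseq)
  show "integrable M (g n)" for n by (rule square_integrable_imp_integrable[OF M g])
  have [measurable]: "g n \<in> borel_measurable M" for n using g by (simp add: square_integrable_def)
  \<comment> \<open>The multiplier \<open>sgn (g n x)\<close> turns the product into an absolute
    value; the constant 1 is square integrable as \<open>M\<close> is finite.\<close>
  have "(\<lambda>n. \<integral>x. 1 * (sgn (g n x) * g n x) \<partial>M) \<longlonglongrightarrow> 0"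
    by (rule integral_mult_tendsto_zero[OF square_integrable_bounded[OF M, of _ 1] g lim])
       (auto simp: sgn_if)
  then show "(\<lambda>n. \<integral>x. norm (g n x) \<partial>M) \<longlonglongrightarrow> 0"
    by (simp add: abs_sgn mult.commute)
qed

section \<open>Functions orthogonal to all functions of a given one\<close>

text \<open>Uniqueness of characteristic functions concerns probability measures on the line; the
  normalised weights below are brought into that form.\<close>

lemma real_distribution_weighted_distr:
  assumes h: "integrable M h" "\<And>x. 0 \<le> h x" "(\<integral>x. h x \<partial>M) = 1" and f: "f \<in> borel_measurable M"
  shows "real_distribution (distr (density M (\<lambda>x. ennreal (h x))) borel f)"
proof -
  have "emeasure (density M (\<lambda>x. ennreal (h x))) (space M) = (\<integral>\<^sup>+ x. ennreal (h x) \<partial>M)"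
    using h(1) by (auto simp: emeasure_density intro!: nn_integral_cong)
  also have "\<dots> = 1"
    using h by (simp add: nn_integral_eq_integral)
  finally have "prob_space (density M (\<lambda>x. ennreal (h x)))"
    by (intro prob_spaceI) simp
  then have "prob_space (distr (density M (\<lambda>x. ennreal (h x))) borel f)"
    by (rule prob_space.prob_space_distr) (use f in simp)
  then show ?thesis
    by (simp add: real_distribution_def real_distribution_axioms_def)
qed

lemma integral_weighted_distr:
  fixes g :: "real \<Rightarrow> 'b::{banach, second_countable_topology}"
  assumes "h \<in> borel_measurable M" "\<And>x. 0 \<le> h x" "f \<in> borel_measurable M" "g \<in> borel_measurable borel"
  shows "(\<integral>s. g s \<partial>distr (density M (\<lambda>x. ennreal (h x))) borel f) = (\<integral>x. h x *\<^sub>R g (f x) \<partial>M)"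
  using assms by (simp add: integral_distr integral_density)

text \<open>The positive and negative parts of \<open>h\<close>, taken as densities and pushed
  forward by \<open>f\<close>, have the same characteristic function and are therefore the same
  measure. The phase \<open>a\<close> in the hypothesis covers real and imaginary parts at
  once.\<close>

lemma orthogonal_bounded_Borel_from_cos:
  fixes h f :: "'a \<Rightarrow> real"
  assumes h: "integrable M h" and f: "f \<in> borel_measurable M"
    and cos: "\<And>t a. (\<integral>x. h x * cos (t * f x + a) \<partial>M) = 0"
    and b: "b \<in> borel_measurable borel" "\<And>s. \<bar>b s\<bar> \<le> C"
  shows "(\<integral>x. h x * b (f x) \<partial>M) = 0"
proof -
  define hp where "hp x = max (h x) 0" for x
  define hn where "hn x = max (- h x) 0" for x
  have int: "integrable M hp" "integrable M hn"
    unfolding hp_def hn_def using h by auto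
  have meas [measurable]: "hp \<in> borel_measurable M" "hn \<in> borel_measurable M" "h \<in> borel_measurable M"
    "f \<in> borel_measurable M" "b \<in> borel_measurable borel"
    using int h f b by auto
  have nonneg: "0 \<le> hp x" "0 \<le> hn x" for x by (auto simp: hp_def hn_def)
  have split: "h x = hp x - hn x" for x by (auto simp: hp_def hn_def)
  have bounded: "integrable M (\<lambda>x. k x * g (f x))"
    if "integrable M k" "g \<in> borel_measurable borel" "\<And>s. \<bar>g s\<bar> \<le> D" for k D and g :: "real \<Rightarrow> real"
    by (rule integrable_mult_bounded[OF that(1) _ that(3)]) (use that(2) in measurable)
  have eq_cos: "(\<integral>x. hp x * cos (t * f x + a) \<partial>M) = (\<integral>x. hn x * cos (t * f x + a) \<partial>M)" for t a
  proof -
    have "(\<integral>x. hp x * cos (t * f x + a) - hn x * cos (t * f x + a) \<partial>M) = 0"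
      using cos[of t a] by (simp add: split left_diff_distrib)
    then show ?thesis
      by (subst (asm) Bochner_Integration.integral_diff)
         (auto intro!: bounded[of _ "\<lambda>s. cos (t * s + a)" 1] int)
  qed
  define c where "c = (\<integral>x. hp x \<partial>M)"
  \<comment> \<open>At \<open>t = 0\<close> and \<open>a = 0\<close> the two parts have equal mass,
    so one constant normalises both.\<close>
  have c: "c = (\<integral>x. hn x \<partial>M)" using eq_cos[of 0 0] by (simp add: c_def)
  show ?thesis
  proof (cases "c = 0")
    case True
    then have "AE x in M. hp x = 0" "AE x in M. hn x = 0"
      using integral_nonneg_eq_0_iff_AE[OF int(1)] integral_nonneg_eq_0_iff_AE[OF int(2)] nonneg c
      by (simp_all add: c_def)
    then have "AE x in M. h x * b (f x) = 0"
      by eventually_elim (simp add: split)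
    then show ?thesis by (simp add: integral_eq_zero_AE)
  next
    case False
    define N where "N k = distr (density M (\<lambda>x. ennreal (k x / c))) borel f" for k
    have "c > 0" using False nonneg by (simp add: c_def less_le)
    have N: "real_distribution (N hp)" "real_distribution (N hn)"
      unfolding N_def using int nonneg \<open>c > 0\<close> c c_def[symmetric]
      by (auto intro!: real_distribution_weighted_distr)
    have N_int: "(\<integral>s. g s \<partial>N k) = (\<integral>x. (k x / c) *\<^sub>R g (f x) \<partial>M)"
      if "k \<in> borel_measurable M" "\<And>x. 0 \<le> k x" "g \<in> borel_measurable borel"
      for k and g :: "real \<Rightarrow> 'b::{banach, second_countable_topology}"
      unfolding N_def using that \<open>c > 0\<close> by (intro integral_weighted_distr) auto
    \<comment> \<open>The phase \<open>- (pi / 2)\<close> turns the cosine into a sine, so that both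
      terms have the form compared in \<open>eq_cos\<close>.\<close>
    have char_N: "char (N k) t = complex_of_real ((\<integral>x. k x * cos (t * f x + 0) \<partial>M) / c) +
        \<i> * complex_of_real ((\<integral>x. k x * cos (t * f x + - (pi / 2)) \<partial>M) / c)"
      if k: "integrable M k" "\<And>x. 0 \<le> k x" for k t
    proof -
      have [measurable]: "k \<in> borel_measurable M" using k by auto
      have "char (N k) t = (\<integral>x. (k x / c) *\<^sub>R iexp (t * f x) \<partial>M)"
        unfolding char_def by (rule N_int) (use k in auto)
      also have "\<dots> = (\<integral>x. complex_of_real (k x * cos (t * f x) / c) + \<i> * complex_of_real (k x * sin (t * f x) / c) \<partial>M)"
        by (intro Bochner_Integration.integral_cong refl)
           (simp add: complex_eq_iff Re_exp Im_exp)
      also have "\<dots> = (\<integral>x. complex_of_real (k x * cos (t * f x) / c) \<partial>M) + (\<integral>x. \<i> * complex_of_real (k x * sin (t * f x) / c) \<partial>M)"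
        by (intro Bochner_Integration.integral_add integrable_mult_right integrable_of_real integrable_divide
              bounded[of _ "\<lambda>s. cos (t * s)" 1] bounded[of _ "\<lambda>s. sin (t * s)" 1] k) auto
      finally show ?thesis
        by (simp add: cos_diff integral_of_real del: of_real_divide of_real_mult)
    qed
    have "char (N hp) = char (N hn)"
      by (rule ext) (simp only: char_N int nonneg eq_cos)
    then have NN: "N hp = N hn" using N Levy_uniqueness by blast
    have "(\<integral>x. (hp x / c) *\<^sub>R b (f x) \<partial>M) = (\<integral>x. (hn x / c) *\<^sub>R b (f x) \<partial>M)"
      by (subst (1 2) N_int[symmetric]) (simp_all add: nonneg NN)
    then have "(\<integral>x. hp x * b (f x) \<partial>M) = (\<integral>x. hn x * b (f x) \<partial>M)"
      using \<open>c > 0\<close> by simp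
    then show ?thesis
      using bounded[OF int(1) b] bounded[OF int(2) b] by (simp add: split left_diff_distrib)
  qed
qed

section \<open>Jensen's inequality by tangents, and its analogue for essential bounds\<close>

lemma powr_tangent_pos:
  fixes s r q :: real
  assumes "1 \<le> q" "0 < s"
  shows "s powr q + q * s powr (q - 1) * (r - s) \<le> \<bar>r\<bar> powr q"
proof (cases "0 < r")
  case True
  have "((\<lambda>x. x powr q) has_real_derivative q * s powr (q - 1)) (at s within {0<..})"
    using assms by (auto intro!: derivative_eq_intros)
  from convex_on_imp_above_tangent[OF powr_convex[OF assms(1)] _ _ _ this, of r] assms True
  show ?thesis by (simp add: connected_Ioi interior_open mult.commute)
next
  \<comment> \<open>For \<open>r \<le> 0\<close> the tangent at \<open>s\<close> has value at most
    \<open>(1 - q) * s powr q\<close>, which is not positive.\<close>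
  case False
  have "s powr (q - 1) * s = s powr q"
    using assms powr_add[of s "q - 1" 1] by simp
  then have "s powr q + q * s powr (q - 1) * (r - s) = (1 - q) * s powr q + q * s powr (q - 1) * r"
    by (simp add: algebra_simps)
  also have "\<dots> \<le> 0"
    using assms False by (intro add_nonpos_nonpos mult_nonpos_nonneg mult_nonneg_nonpos) auto
  also have "\<dots> \<le> \<bar>r\<bar> powr q" by simp
  finally show ?thesis .
qed

text \<open>Reflecting both variables reduces negative \<open>s\<close> to positive
  \<open>s\<close>. At \<open>s = 0\<close> the factor \<open>sgn s\<close> and the value
  \<open>0 powr q = 0\<close> make the left side zero; the slope 0 chosen there is also a
  subgradient for \<open>q = 1\<close>, where the absolute value has a corner.\<close>

lemma powr_tangent:
  fixes s r q :: real
  assumes "1 \<le> q"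
  shows "\<bar>s\<bar> powr q + q * (\<bar>s\<bar> powr (q - 1) * sgn s) * (r - s) \<le> \<bar>r\<bar> powr q"
proof (cases s "0 :: real" rule: linorder_cases)
  case less
  from powr_tangent_pos[OF assms, of "- s" "- r"] less show ?thesis by (simp add: algebra_simps)
next
  case greater
  from powr_tangent_pos[OF assms greater, of r] greater show ?thesis by simp
qed simp

text \<open>Conditional Jensen inequality: \<open>orth\<close> says that \<open>f\<close> is the
  conditional expectation of \<open>g\<close> given \<open>f\<close>. The tangent inequality at
  \<open>f x\<close> is integrated, with the slope as test function, so that the linear term drops
  out. Truncation makes the slope bounded and is lifted by monotone convergence.\<close>

lemma martingale_nn_integral_powr_le:
  fixes f g :: "'a \<Rightarrow> real"
  assumes M: "finite_measure M" and f: "integrable M f" and g: "integrable M g" and q: "1 \<le> q"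
    and orth: "\<And>b C. b \<in> borel_measurable borel \<Longrightarrow> (\<And>s. \<bar>b s\<bar> \<le> (C::real)) \<Longrightarrow> (\<integral>x. (f x - g x) * b (f x) \<partial>M) = 0"
  shows "(\<integral>\<^sup>+ x. ennreal (\<bar>f x\<bar> powr q) \<partial>M) \<le> (\<integral>\<^sup>+ x. ennreal (\<bar>g x\<bar> powr q) \<partial>M)"
proof (cases "(\<integral>\<^sup>+ x. ennreal (\<bar>g x\<bar> powr q) \<partial>M) = \<infinity>")
  case False
  have [measurable]: "f \<in> borel_measurable M" "g \<in> borel_measurable M" using f g by auto
  have gq: "integrable M (\<lambda>x. \<bar>g x\<bar> powr q)"
    using False by (intro integrableI_bounded) (auto simp: less_top)
  define I where "I n s = (if \<bar>s\<bar> \<le> real n then 1 else 0 :: real)" for n s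
  have [measurable]: "I n \<in> borel_measurable borel" for n unfolding I_def by measurable
  have le: "(\<integral>\<^sup>+ x. ennreal (I n (f x) * \<bar>f x\<bar> powr q) \<partial>M) \<le> (\<integral>\<^sup>+ x. ennreal (\<bar>g x\<bar> powr q) \<partial>M)" for n
  proof -
    define b where "b s = I n s * (\<bar>s\<bar> powr (q - 1) * sgn s)" for s
    have [measurable]: "b \<in> borel_measurable borel" unfolding b_def by measurable
    have b: "\<bar>b s\<bar> \<le> real n powr (q - 1)" for s
      using q by (auto simp: b_def I_def abs_mult abs_sgn_eq intro!: powr_mono2)
    have int1: "integrable M (\<lambda>x. I n (f x) * \<bar>f x\<bar> powr q)"
    proof (rule finite_measure.integrable_const_bound[OF M])
      show "AE x in M. norm (I n (f x) * \<bar>f x\<bar> powr q) \<le> real n powr q"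
        using q by (intro AE_I2) (auto simp: I_def intro!: powr_mono2)
    qed measurable
    have int2: "integrable M (\<lambda>x. (f x - g x) * b (f x))"
    proof (rule Bochner_Integration.integrable_bound)
      show "integrable M (\<lambda>x. real n powr (q - 1) * (f x - g x))" using f g by simp
      show "AE x in M. norm ((f x - g x) * b (f x)) \<le> norm (real n powr (q - 1) * (f x - g x))"
        using b by (intro AE_I2) (simp add: abs_mult mult.commute[of "real n powr _"] mult_left_mono)
    qed measurable
    \<comment> \<open>The subtracted integral is zero by \<open>orth\<close>; it turns the integrand
      into the truncated tangent, which can be compared pointwise.\<close>
    have "(\<integral>x. I n (f x) * \<bar>f x\<bar> powr q \<partial>M) = (\<integral>x. I n (f x) * \<bar>f x\<bar> powr q - q * ((f x - g x) * b (f x)) \<partial>M)"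
      using orth[of b, OF _ b] int1 int2 by simp
    also have "\<dots> \<le> (\<integral>x. \<bar>g x\<bar> powr q \<partial>M)"
    proof (rule integral_mono)
      fix x
      have "I n (f x) * \<bar>f x\<bar> powr q - q * ((f x - g x) * b (f x)) =
          I n (f x) * (\<bar>f x\<bar> powr q + q * (\<bar>f x\<bar> powr (q - 1) * sgn (f x)) * (g x - f x))"
        by (simp add: b_def algebra_simps)
      also have "\<dots> \<le> \<bar>g x\<bar> powr q"
        using powr_tangent[OF q, of "f x" "g x"] by (simp add: I_def)
      finally show "I n (f x) * \<bar>f x\<bar> powr q - q * ((f x - g x) * b (f x)) \<le> \<bar>g x\<bar> powr q" .
    qed (use int1 int2 gq in auto)
    finally have "ennreal (\<integral>x. I n (f x) * \<bar>f x\<bar> powr q \<partial>M) \<le> ennreal (\<integral>x. \<bar>g x\<bar> powr q \<partial>M)"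
      by (rule ennreal_leI)
    then show ?thesis
      using int1 gq by (simp add: nn_integral_eq_integral I_def)
  qed
  have "(\<lambda>n. \<integral>\<^sup>+ x. ennreal (I n (f x) * \<bar>f x\<bar> powr q) \<partial>M) \<longlonglongrightarrow> (\<integral>\<^sup>+ x. ennreal (\<bar>f x\<bar> powr q) \<partial>M)"
  proof (rule nn_integral_LIMSEQ)
    show "incseq (\<lambda>n x. ennreal (I n (f x) * \<bar>f x\<bar> powr q))"
      by (auto simp: incseq_def le_fun_def I_def intro!: ennreal_leI)
    show "(\<lambda>n. ennreal (I n (f x) * \<bar>f x\<bar> powr q)) \<longlonglongrightarrow> ennreal (\<bar>f x\<bar> powr q)" for x
    proof (rule tendsto_eventually)
      obtain n0 :: nat where n0: "\<bar>f x\<bar> \<le> n0" using real_arch_simple by blast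
      have "I n (f x) = 1" if "n \<ge> n0" for n using that n0 by (auto simp: I_def)
      then show "eventually (\<lambda>n. ennreal (I n (f x) * \<bar>f x\<bar> powr q) = ennreal (\<bar>f x\<bar> powr q)) sequentially"
        unfolding eventually_sequentially by (intro exI[of _ n0]) simp
    qed
  qed measurable
  then show ?thesis
    by (rule LIMSEQ_le_const2) (use le in auto)
qed simp

text \<open>Tested with the indicator of \<open>{s. m < s}\<close>, the integrand is nonnegative
  almost everywhere and positive where \<open>f x\<close> exceeds \<open>m\<close> and
  \<open>g x\<close> does not. Its integral is zero, so that set is null.\<close>

lemma martingale_AE_le:
  fixes f g :: "'a \<Rightarrow> real"
  assumes f: "integrable M f" and g: "integrable M g"
    and orth: "\<And>b C. b \<in> borel_measurable borel \<Longrightarrow> (\<And>s. \<bar>b s\<bar> \<le> (C::real)) \<Longrightarrow> (\<integral>x. (f x - g x) * b (f x) \<partial>M) = 0"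
    and le: "AE x in M. g x \<le> m"
  shows "AE x in M. f x \<le> m"
proof -
  have [measurable]: "f \<in> borel_measurable M" "g \<in> borel_measurable M" using f g by auto
  define b where "b s = (if m < s then 1 else 0 :: real)" for s
  have [measurable]: "b \<in> borel_measurable borel" unfolding b_def by measurable
  have int: "integrable M (\<lambda>x. (f x - g x) * b (f x))"
  proof (rule Bochner_Integration.integrable_bound)
    show "integrable M (\<lambda>x. f x - g x)" using f g by simp
    show "AE x in M. norm ((f x - g x) * b (f x)) \<le> norm (f x - g x)"
      by (intro AE_I2) (simp add: b_def)
  qed measurable
  have nonneg: "AE x in M. 0 \<le> (f x - g x) * b (f x)"
    using le by eventually_elim (simp add: b_def)
  have "(\<integral>x. (f x - g x) * b (f x) \<partial>M) = 0"
    by (rule orth[of b 1]) (auto simp: b_def[abs_def])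
  then have "AE x in M. (f x - g x) * b (f x) = 0"
    using integral_nonneg_eq_0_iff_AE[OF int nonneg] by simp
  then show ?thesis
    using le by eventually_elim (auto simp: b_def split: if_splits)
qed

text \<open>The one-sided bound is applied to \<open>f\<close>, \<open>g\<close> and to their
  negatives; orthogonality passes to the negatives through
  \<open>\<lambda>s. b (- s)\<close>.\<close>

lemma martingale_AE_abs_le:
  fixes f g :: "'a \<Rightarrow> real"
  assumes f: "integrable M f" and g: "integrable M g"
    and orth: "\<And>b C. b \<in> borel_measurable borel \<Longrightarrow> (\<And>s. \<bar>b s\<bar> \<le> (C::real)) \<Longrightarrow> (\<integral>x. (f x - g x) * b (f x) \<partial>M) = 0"
    and le: "AE x in M. \<bar>g x\<bar> \<le> m"
  shows "AE x in M. \<bar>f x\<bar> \<le> m"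
proof -
  have le': "AE x in M. g x \<le> m" "AE x in M. - g x \<le> m"
    using le by (eventually_elim; simp)+
  have orth': "(\<integral>x. (- f x - - g x) * b (- f x) \<partial>M) = 0"
    if b: "b \<in> borel_measurable borel" "\<And>s. \<bar>b s\<bar> \<le> (C::real)" for b C
  proof -
    have "(\<lambda>s. b (- s)) \<in> borel_measurable borel" using b(1) by measurable
    from orth[OF this, of C] b(2) have "(\<integral>x. (f x - g x) * b (- f x) \<partial>M) = 0" by blast
    moreover have "(\<lambda>x. (- f x - - g x) * b (- f x)) = (\<lambda>x. - ((f x - g x) * b (- f x)))"
      by (simp add: algebra_simps)
    ultimately show ?thesis by simp
  qed
  have "AE x in M. f x \<le> m"
    by (rule martingale_AE_le[OF f g orth le'(1)])
  moreover have "AE x in M. - f x \<le> m"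
    by (rule martingale_AE_le[OF integrable_minus[OF f] integrable_minus[OF g] orth' le'(2)])
  ultimately show ?thesis by eventually_elim auto
qed

section \<open>Smooth functions and the Hartley basis of the torus\<close>

lemma partial_eqI:
  "(f has_derivative f') (at x) \<Longrightarrow> partial i f x = f' (axis i 1)"
  by (simp add: partial_def frechet_derivative_at[symmetric])

lemma has_derivative_partial:
  "f differentiable (at x) \<Longrightarrow> \<exists>f'. (f has_derivative f') (at x) \<and> (\<forall>i. f' (axis i 1) = partial i f x)"
  by (metis frechet_derivative_works partial_def)

text \<open>A syntactic class that contains \<open>sin (t * P x + a)\<close> for trigonometric
  polynomials \<open>P\<close> and is closed under partial derivatives, so that \<open>Ck k\<close>
  follows for all \<open>k\<close> by induction without computing higher derivatives.\<close>

inductive_set elementary :: "(real^2 \<Rightarrow> real) set" where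
  linear: "(\<lambda>x. k \<bullet> x) \<in> elementary"
| const: "(\<lambda>x. c) \<in> elementary"
| add: "f \<in> elementary \<Longrightarrow> g \<in> elementary \<Longrightarrow> (\<lambda>x. f x + g x) \<in> elementary"
| mult: "f \<in> elementary \<Longrightarrow> g \<in> elementary \<Longrightarrow> (\<lambda>x. f x * g x) \<in> elementary"
| sin: "f \<in> elementary \<Longrightarrow> (\<lambda>x. sin (f x)) \<in> elementary"
| cos: "f \<in> elementary \<Longrightarrow> (\<lambda>x. cos (f x)) \<in> elementary"

lemma partial_sin:
  assumes "f differentiable (at x)"
  shows "partial i (\<lambda>x. sin (f x)) x = cos (f x) * partial i f x"
proof -
  obtain f' where f': "(f has_derivative f') (at x)" "f' (axis i 1) = partial i f x"
    using has_derivative_partial[OF assms] by blast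
  have "((\<lambda>x. sin (f x)) has_derivative (\<lambda>h. cos (f x) * f' h)) (at x)"
    using has_derivative_compose[OF f'(1) DERIV_sin[of "f x", unfolded has_field_derivative_def]] by simp
  from partial_eqI[OF this] f'(2) show ?thesis by simp
qed

lemma partial_cos:
  assumes "f differentiable (at x)"
  shows "partial i (\<lambda>x. cos (f x)) x = - sin (f x) * partial i f x"
proof -
  obtain f' where f': "(f has_derivative f') (at x)" "f' (axis i 1) = partial i f x"
    using has_derivative_partial[OF assms] by blast
  have "((\<lambda>x. cos (f x)) has_derivative (\<lambda>h. - sin (f x) * f' h)) (at x)"
    using has_derivative_compose[OF f'(1) DERIV_cos[of "f x", unfolded has_field_derivative_def]] by simp
  from partial_eqI[OF this] f'(2) show ?thesis by simp
qed

lemma partial_add: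
  assumes "f differentiable (at x)" "g differentiable (at x)"
  shows "partial i (\<lambda>x. f x + g x) x = partial i f x + partial i g x"
proof -
  obtain f' g' where f': "(f has_derivative f') (at x)" "f' (axis i 1) = partial i f x"
    and g': "(g has_derivative g') (at x)" "g' (axis i 1) = partial i g x"
    using has_derivative_partial[OF assms(1)] has_derivative_partial[OF assms(2)] by blast
  from partial_eqI[OF has_derivative_add[OF f'(1) g'(1)]] f'(2) g'(2) show ?thesis by simp
qed

lemma partial_mult:
  fixes f g :: "real^2 \<Rightarrow> real"
  assumes "f differentiable (at x)" "g differentiable (at x)"
  shows "partial i (\<lambda>x. f x * g x) x = f x * partial i g x + partial i f x * g x"
proof -
  obtain f' g' where f': "(f has_derivative f') (at x)" "f' (axis i 1) = partial i f x"
    and g': "(g has_derivative g') (at x)" "g' (axis i 1) = partial i g x"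
    using has_derivative_partial[OF assms(1)] has_derivative_partial[OF assms(2)] by blast
  from partial_eqI[OF has_derivative_mult[OF f'(1) g'(1)]] f'(2) g'(2) show ?thesis by simp
qed

lemma elementary_differentiable:
  "f \<in> elementary \<Longrightarrow> f differentiable (at x)"
proof (induction rule: elementary.induct)
  case (sin f)
  then show ?case
    using has_derivative_compose[OF _ DERIV_sin[unfolded has_field_derivative_def]]
    by (metis differentiable_def)
next
  case (cos f)
  then show ?case
    using has_derivative_compose[OF _ DERIV_cos[unfolded has_field_derivative_def]]
    by (metis differentiable_def)
qed (auto intro: differentiableI has_derivative_inner_right has_derivative_ident differentiable_add differentiable_mult)

lemma elementary_partial:
  "f \<in> elementary \<Longrightarrow> partial i f \<in> elementary"
proof (induction rule: elementary.induct)
  case (linear k)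
  have "partial i (\<lambda>x. k \<bullet> x) = (\<lambda>x. k \<bullet> axis i 1)"
    by (rule ext) (auto intro!: partial_eqI derivative_eq_intros)
  then show ?case by (simp add: elementary.const)
next
  case (const c)
  have "partial i (\<lambda>x. c) = (\<lambda>x. 0)"
    by (rule ext) (auto intro!: partial_eqI derivative_eq_intros)
  then show ?case by (simp add: elementary.const)
next
  case (add f g)
  then have "partial i (\<lambda>x. f x + g x) = (\<lambda>x. partial i f x + partial i g x)"
    by (intro ext partial_add elementary_differentiable)
  then show ?case using add by (simp add: elementary.add)
next
  case (mult f g)
  then have "partial i (\<lambda>x. f x * g x) = (\<lambda>x. f x * partial i g x + partial i f x * g x)"
    by (intro ext partial_mult elementary_differentiable)
  then show ?case using mult by (auto intro!: elementary.add elementary.mult)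
next
  case (sin f)
  then have "partial i (\<lambda>x. sin (f x)) = (\<lambda>x. cos (f x) * partial i f x)"
    by (intro ext partial_sin elementary_differentiable)
  then show ?case using sin by (auto intro!: elementary.cos elementary.mult)
next
  case (cos f)
  then have "partial i (\<lambda>x. cos (f x)) = (\<lambda>x. ((- 1) * sin (f x)) * partial i f x)"
    by (intro ext) (simp add: partial_cos elementary_differentiable)
  then show ?case using cos
    by (simp only:) (intro elementary.sin elementary.mult elementary.const)
qed

lemma elementary_Ck: "f \<in> elementary \<Longrightarrow> Ck k f"
proof (induction k arbitrary: f)
  case 0
  then show ?case
    using elementary_differentiable differentiable_imp_continuous_on[of f UNIV]
    by (simp add: differentiable_on_def)
qed (simp add: elementary_partial elementary_differentiable)

lemma elementary_test_function:
  "f \<in> elementary \<Longrightarrow> Z2_periodic f \<Longrightarrow> f \<in> test_functions"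
  by (simp add: test_functions_def elementary_Ck)

lemma elementary_sum:
  "(\<And>k. k \<in> A \<Longrightarrow> f k \<in> elementary) \<Longrightarrow> (\<lambda>x. \<Sum>k\<in>A. f k x) \<in> elementary"
  by (induction A rule: infinite_finite_induct) (auto intro: elementary.const elementary.add)

lemma elementary_continuous: "f \<in> elementary \<Longrightarrow> continuous_on UNIV f"
  using elementary_Ck[of f 0] by simp

section \<open>The Hartley functions\<close>

definition freqs :: "(real^2) set" where
  "freqs = {k. \<forall>i. k $ i \<in> \<int>}"

text \<open>The kernel \<open>cas\<close> of the Hartley transform. One real function per integer
  frequency yields an orthonormal system without complex values and without choosing one frequency
  from each pair \<open>k\<close>, \<open>- k\<close>.\<close>

definition hartley :: "real^2 \<Rightarrow> real^2 \<Rightarrow> real" where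
  "hartley k x = cos (2 * pi * (k \<bullet> x)) + sin (2 * pi * (k \<bullet> x))"

lemma freqs_minus: "k \<in> freqs \<Longrightarrow> - k \<in> freqs"
  and freqs_add: "k \<in> freqs \<Longrightarrow> l \<in> freqs \<Longrightarrow> k + l \<in> freqs"
  and freqs_diff: "k \<in> freqs \<Longrightarrow> l \<in> freqs \<Longrightarrow> k - l \<in> freqs"
  and freqs_0: "0 \<in> freqs"
  by (auto simp: freqs_def)

lemma hartley_elementary: "hartley k \<in> elementary"
proof -
  have "(\<lambda>x. (2 * pi) * (k \<bullet> x)) \<in> elementary"
    by (intro elementary.mult elementary.const elementary.linear)
  then have "(\<lambda>x. cos (2 * pi * (k \<bullet> x)) + sin (2 * pi * (k \<bullet> x))) \<in> elementary"
    by (intro elementary.intros)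
  then show ?thesis by (simp add: hartley_def[abs_def])
qed

lemma hartley_periodic: "k \<in> freqs \<Longrightarrow> Z2_periodic (hartley k)"
proof (unfold Z2_periodic_def, intro allI)
  fix x i assume "k \<in> freqs"
  then obtain n :: int where n: "k $ i = n"
    by (auto simp: freqs_def elim: Ints_cases)
  have "2 * pi * (k \<bullet> (x + axis i 1)) = 2 * pi * (k \<bullet> x) + 2 * pi * of_int n"
    by (simp add: inner_add_right inner_axis n algebra_simps)
  then show "hartley k (x + axis i 1) = hartley k x"
    unfolding hartley_def by (simp add: cos_add sin_add)
qed

lemma hartley_test: "k \<in> freqs \<Longrightarrow> hartley k \<in> test_functions"
  by (simp add: elementary_test_function hartley_elementary hartley_periodic)

text \<open>The derivative of cos + sin is cos - sin, the Hartley function of the opposite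
  frequency: differentiation couples \<open>k\<close> with \<open>- k\<close>.\<close>

lemma partial_hartley: "partial i (hartley k) x = 2 * pi * k $ i * hartley (- k) x"
proof -
  have "(hartley k has_derivative (\<lambda>h. - sin (2 * pi * (k \<bullet> x)) * (2 * pi * (k \<bullet> h)) + cos (2 * pi * (k \<bullet> x)) * (2 * pi * (k \<bullet> h)))) (at x)"
    unfolding hartley_def[abs_def]
    by (rule derivative_eq_intros refl | simp add: algebra_simps)+
  from partial_eqI[OF this, of i] show ?thesis
    by (simp add: hartley_def inner_axis algebra_simps)
qed

lemma cos_freq_hartley: "cos (2 * pi * (k \<bullet> x)) = (hartley k x + hartley (- k) x) / 2"
  and sin_freq_hartley: "sin (2 * pi * (k \<bullet> x)) = (hartley k x - hartley (- k) x) / 2"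
  by (simp_all add: hartley_def)

text \<open>The product rule of \<open>cas\<close>. It yields orthonormality and the closure of
  trigonometric polynomials under multiplication.\<close>

lemma hartley_mult:
  "hartley k x * hartley l x = cos (2 * pi * ((k - l) \<bullet> x)) + sin (2 * pi * ((k + l) \<bullet> x))"
  by (simp add: hartley_def inner_diff_left inner_add_left right_diff_distrib distrib_left
      cos_diff sin_add algebra_simps)

lemma hartley_bound: "\<bar>hartley k x\<bar> \<le> 2"
  unfolding hartley_def
  using abs_cos_le_one[of "2 * pi * (k \<bullet> x)"] abs_sin_le_one[of "2 * pi * (k \<bullet> x)"] by linarith

section \<open>Integrals over the unit square and orthonormality\<close>

lemma finite_measure_torus: "finite_measure torus"
  unfolding torus_def by (rule finite_measure_lebesgue_on) simp

lemma space_torus: "space torus = cbox 0 One"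
  by (simp add: torus_def)

lemma continuous_measurable_torus:
  fixes f :: "real^2 \<Rightarrow> 'a::topological_space"
  assumes "continuous_on UNIV f"
  shows "f \<in> borel_measurable torus"
  unfolding torus_def
  by (intro measurable_restrict_space1 measurable_completion)
     (simp add: assms borel_measurable_continuous_onI)

lemma hartley_measurable: "hartley k \<in> borel_measurable torus"
  by (intro continuous_measurable_torus elementary_continuous hartley_elementary)

text \<open>For a nonzero integer \<open>c\<close> the exponential has an antiderivative with equal
  values at 0 and 1.\<close>

lemma integral_cis_unit:
  fixes c :: real
  assumes "c \<in> \<int>"
  shows "(\<integral>t. indicator {0..1} t *\<^sub>R cis (2 * pi * (c * t)) \<partial>lborel) = of_bool (c = 0)"
    "integrable lborel (\<lambda>t. indicator {0..1} t *\<^sub>R cis (2 * pi * (c * t)))"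
proof -
  show "integrable lborel (\<lambda>t. indicator {0..1} t *\<^sub>R cis (2 * pi * (c * t)))"
    by (rule borel_integrable_compact) (auto intro!: continuous_intros)
  show "(\<integral>t. indicator {0..1} t *\<^sub>R cis (2 * pi * (c * t)) \<partial>lborel) = of_bool (c = 0)"
  proof (cases "c = 0")
    case True
    then show ?thesis by simp
  next
    case False
    obtain n :: int where n: "c = n" using assms by (auto elim: Ints_cases)
    define F where "F t = cis (2 * pi * (c * t)) / (\<i> * (2 * pi * c))" for t
    have "(\<integral>t. indicator {0..1} t *\<^sub>R cis (2 * pi * (c * t)) \<partial>lborel) = F 1 - F 0"
    proof (rule integral_FTC_Icc)
      show "(F has_vector_derivative cis (2 * pi * (c * t))) (at t within {0..1})" for t
      proof -
        have "((\<lambda>z. exp (\<i> * (2 * pi * c) * z) / (\<i> * (2 * pi * c))) has_field_derivative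
            exp (\<i> * (2 * pi * c) * of_real t)) (at (of_real t))"
          using False by (auto intro!: derivative_eq_intros)
        from has_vector_derivative_real_field[OF this]
        show ?thesis by (simp add: F_def[abs_def] cis_conv_exp o_def mult_ac)
      qed
    qed (auto intro!: continuous_intros)
    also have "F 1 = F 0"
      using cis_multiple_2pi[of "c"] assms by (simp add: F_def mult_ac)
    finally show ?thesis using False by simp
  qed
qed

text \<open>The exponential and the indicator of the square both factor over the coordinates, so the
  integral is a product of integrals over the unit interval; one of them vanishes unless
  \<open>k = 0\<close>.\<close>

lemma integral_torus_cis:
  assumes "k \<in> freqs"
  shows "(\<integral>x. cis (2 * pi * (k \<bullet> x)) \<partial>torus) = of_bool (k = 0)"
proof -
  interpret product_sigma_finite "\<lambda>b::real^2. lborel :: real measure" ..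
  define g where "g b t = indicator {0..1} t *\<^sub>R cis (2 * pi * (k \<bullet> b * t))" for b :: "real^2" and t :: real
  have kb: "k \<bullet> b \<in> \<int>" if "b \<in> Basis" for b
    using that assms by (auto simp: Basis_vec_def inner_axis freqs_def)
  have prod_cis: "(\<Prod>b\<in>B. cis (h b)) = cis (\<Sum>b\<in>B. h b)" for B and h :: "real^2 \<Rightarrow> real"
    by (induction B rule: infinite_finite_induct) (auto simp: cis_mult)
  have prod_ind: "(\<Prod>b\<in>B. indicator {0..1} (h b)) = (of_bool (\<forall>b\<in>B. h b \<in> {0..1}) :: real)"
    if "finite B" for B and h :: "real^2 \<Rightarrow> real"
    using that by induction (auto simp: indicator_def)
  have prod_g: "indicator (cbox 0 One) (\<Sum>b\<in>Basis. f b *\<^sub>R b) *\<^sub>R cis (2 * pi * (k \<bullet> (\<Sum>b\<in>Basis. f b *\<^sub>R b)))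
      = (\<Prod>b\<in>Basis. g b (f b))" for f
  proof -
    have "(\<Prod>b\<in>Basis. g b (f b)) = (\<Prod>b\<in>Basis. of_real (indicator {0..1} (f b)) * cis (2 * pi * (k \<bullet> b * f b)))"
      by (simp add: g_def scaleR_conv_of_real)
    also have "\<dots> = of_real (\<Prod>b\<in>Basis. indicator {0..1} (f b)) * cis (\<Sum>b\<in>Basis. 2 * pi * (k \<bullet> b * f b))"
      by (simp only: prod.distrib prod_cis of_real_prod)
    also have "(\<Sum>b\<in>Basis. 2 * pi * (k \<bullet> b * f b)) = 2 * pi * (k \<bullet> (\<Sum>b\<in>Basis. f b *\<^sub>R b))"
      by (simp add: inner_sum_right sum_distrib_left mult_ac)
    also have "(\<Prod>b\<in>Basis. indicator {0..1} (f b)) = (indicator (cbox 0 One) (\<Sum>b\<in>Basis. f b *\<^sub>R b) :: real)"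
      by (subst prod_ind) (auto simp: indicator_def mem_box)
    finally show ?thesis by (simp add: scaleR_conv_of_real)
  qed
  have meas: "(\<lambda>x. indicator (cbox 0 One) x *\<^sub>R cis (2 * pi * (k \<bullet> x))) \<in> borel_measurable borel"
    by (intro borel_measurable_scaleR borel_measurable_indicator borel_measurable_continuous_onI continuous_intros) auto
  have "(\<integral>x. cis (2 * pi * (k \<bullet> x)) \<partial>torus) = (\<integral>x. indicator (cbox 0 One) x *\<^sub>R cis (2 * pi * (k \<bullet> x)) \<partial>lebesgue)"
    unfolding torus_def by (rule integral_restrict_space) simp
  also have "\<dots> = (\<integral>x. indicator (cbox 0 One) x *\<^sub>R cis (2 * pi * (k \<bullet> x)) \<partial>lborel)"
    using meas by (intro integral_completion) simp
  \<comment> \<open>By \<open>lborel_eq\<close>, Lebesgue measure on the plane is the image of a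
    product measure indexed by \<open>Basis\<close>.\<close>
  also have "\<dots> = (\<integral>f. (\<Prod>b\<in>Basis. g b (f b)) \<partial>(\<Pi>\<^sub>M b\<in>Basis. lborel))"
    unfolding prod_g[symmetric]
    by (subst lborel_eq, rule integral_distr) (use meas in \<open>auto intro!: borel_measurable_sum\<close>)
  also have "\<dots> = (\<Prod>b\<in>Basis. (\<integral>t. g b t \<partial>lborel))"
    by (rule product_integral_prod) (simp_all add: g_def integral_cis_unit kb)
  also have "\<dots> = (\<Prod>b\<in>Basis. of_bool (k \<bullet> b = 0))"
    by (intro prod.cong refl) (simp add: g_def integral_cis_unit kb)
  also have "\<dots> = of_bool (\<forall>b\<in>Basis. k \<bullet> b = 0)"
    by (auto simp: of_bool_def)
  also have "(\<forall>b\<in>Basis. k \<bullet> b = 0) \<longleftrightarrow> k = 0"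
    by (metis euclidean_eqI inner_zero_left)
  finally show ?thesis .
qed

lemma integrable_torus_continuous:
  fixes f :: "real^2 \<Rightarrow> 'a::{banach, second_countable_topology}"
  assumes "continuous_on UNIV f" "\<And>x. norm (f x) \<le> C"
  shows "integrable torus f"
  by (rule finite_measure.integrable_const_bound[OF finite_measure_torus])
     (use assms continuous_measurable_torus in auto)

lemma integral_torus_cos:
  assumes "k \<in> freqs" shows "(\<integral>x. cos (2 * pi * (k \<bullet> x)) \<partial>torus) = of_bool (k = 0)"
proof -
  have "integrable torus (\<lambda>x. cis (2 * pi * (k \<bullet> x)))"
    by (rule integrable_torus_continuous[where C = 1]) (auto intro!: continuous_intros)
  from integral_Re[OF this] integral_torus_cis[OF assms] show ?thesis by simp
qed

lemma integral_torus_sin: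
  assumes "k \<in> freqs" shows "(\<integral>x. sin (2 * pi * (k \<bullet> x)) \<partial>torus) = 0"
proof -
  have "integrable torus (\<lambda>x. cis (2 * pi * (k \<bullet> x)))"
    by (rule integrable_torus_continuous[where C = 1]) (auto intro!: continuous_intros)
  from integral_Im[OF this] integral_torus_cis[OF assms] show ?thesis by simp
qed

text \<open>After \<open>hartley_mult\<close> the sine has mean zero, and the cosine at frequency
  \<open>k - l\<close> has mean zero unless this frequency is 0.\<close>

lemma hartley_orthonormal:
  assumes "k \<in> freqs" "l \<in> freqs"
  shows "(\<integral>x. hartley k x * hartley l x \<partial>torus) = of_bool (k = l)"
proof -
  have "integrable torus (\<lambda>x. cos (2 * pi * ((k - l) \<bullet> x)))" "integrable torus (\<lambda>x. sin (2 * pi * ((k + l) \<bullet> x)))"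
    by (rule integrable_torus_continuous[where C = 1]; auto intro!: continuous_intros)+
  then show ?thesis
    using assms by (simp add: hartley_mult integral_torus_cos integral_torus_sin freqs_add freqs_diff)
qed

lemma hartley_square_integrable: "square_integrable torus (hartley k)"
  by (rule square_integrable_bounded[OF finite_measure_torus hartley_measurable hartley_bound])

section \<open>Density of trigonometric polynomials\<close>

definition trig_sum :: "(real^2) set \<Rightarrow> (real^2 \<Rightarrow> real) \<Rightarrow> real^2 \<Rightarrow> real" where
  "trig_sum A c x = (\<Sum>k\<in>A. c k * hartley k x)"

definition trig_poly :: "(real^2 \<Rightarrow> real) \<Rightarrow> bool" where
  "trig_poly P \<longleftrightarrow> (\<exists>A c. finite A \<and> A \<subseteq> freqs \<and> P = trig_sum A c)"

text \<open>Padding with zero coefficients brings sums over different frequency sets to a common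
  one.\<close>

lemma trig_sum_superset:
  assumes "finite B" "A \<subseteq> B"
  shows "trig_sum A c = trig_sum B (\<lambda>k. if k \<in> A then c k else 0)"
proof
  fix x
  have "(\<Sum>k\<in>B. (if k \<in> A then c k else 0) * hartley k x) = (\<Sum>k\<in>A. (if k \<in> A then c k else 0) * hartley k x)"
    by (rule sum.mono_neutral_right) (use assms in auto)
  then show "trig_sum A c x = trig_sum B (\<lambda>k. if k \<in> A then c k else 0) x"
    by (simp add: trig_sum_def)
qed

lemma trig_poly_add:
  assumes "trig_poly P" "trig_poly Q"
  shows "trig_poly (\<lambda>x. P x + Q x)"
proof -
  obtain A c B d where P: "finite A" "A \<subseteq> freqs" "P = trig_sum A c"
    and Q: "finite B" "B \<subseteq> freqs" "Q = trig_sum B d"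
    using assms by (auto simp: trig_poly_def)
  have "(\<lambda>x. P x + Q x) = trig_sum (A \<union> B) (\<lambda>k. (if k \<in> A then c k else 0) + (if k \<in> B then d k else 0))"
    using trig_sum_superset[of "A \<union> B" A c] trig_sum_superset[of "A \<union> B" B d] P Q
    by (auto simp: trig_sum_def fun_eq_iff distrib_right sum.distrib)
  then show ?thesis
    unfolding trig_poly_def using P Q by (intro exI[of _ "A \<union> B"] exI conjI) auto
qed

lemma trig_poly_cmult: "trig_poly P \<Longrightarrow> trig_poly (\<lambda>x. a * P x)"
proof -
  assume "trig_poly P"
  then obtain A c where P: "finite A" "A \<subseteq> freqs" "P = trig_sum A c"
    by (auto simp: trig_poly_def)
  have "(\<lambda>x. a * P x) = trig_sum A (\<lambda>k. a * c k)"
    by (auto simp: P(3) trig_sum_def sum_distrib_left mult.assoc)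
  then show ?thesis using P by (auto simp: trig_poly_def)
qed

lemma trig_poly_hartley: "k \<in> freqs \<Longrightarrow> trig_poly (hartley k)"
  unfolding trig_poly_def
  by (rule exI[of _ "{k}"], rule exI[of _ "\<lambda>_. 1"]) (auto simp: trig_sum_def)

lemma trig_poly_cos: 
  assumes "k \<in> freqs" shows "trig_poly (\<lambda>x. cos (2 * pi * (k \<bullet> x)))"
  using trig_poly_cmult[OF trig_poly_add[OF trig_poly_hartley[OF assms] trig_poly_hartley[OF freqs_minus[OF assms]]], of "1/2"]
  by (simp add: cos_freq_hartley)

lemma trig_poly_sin: 
  assumes "k \<in> freqs" shows "trig_poly (\<lambda>x. sin (2 * pi * (k \<bullet> x)))"
  using trig_poly_cmult[OF trig_poly_add[OF trig_poly_hartley[OF assms]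
    trig_poly_cmult[OF trig_poly_hartley[OF freqs_minus[OF assms]], of "- 1"]], of "1/2"]
  by (simp add: sin_freq_hartley)

lemma trig_poly_const: "trig_poly (\<lambda>x. c)"
  using trig_poly_cmult[OF trig_poly_cos[OF freqs_0], of c] by simp

lemma trig_poly_sum:
  "(\<And>i. i \<in> I \<Longrightarrow> trig_poly (P i)) \<Longrightarrow> trig_poly (\<lambda>x. \<Sum>i\<in>I. P i x)"
  by (induction I rule: infinite_finite_induct) (auto intro: trig_poly_const trig_poly_add)

lemma trig_poly_mult:
  assumes "trig_poly P" "trig_poly Q"
  shows "trig_poly (\<lambda>x. P x * Q x)"
proof -
  obtain A c B d where P: "finite A" "A \<subseteq> freqs" "P = trig_sum A c"
    and Q: "finite B" "B \<subseteq> freqs" "Q = trig_sum B d"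
    using assms by (auto simp: trig_poly_def)
  have eq: "(\<lambda>x. P x * Q x) = (\<lambda>x. \<Sum>k\<in>A. \<Sum>l\<in>B. (c k * d l) * (hartley k x * hartley l x))"
    by (simp add: P Q trig_sum_def sum_product mult_ac)
  show ?thesis
    unfolding eq hartley_mult
    by (intro trig_poly_sum trig_poly_cmult trig_poly_add trig_poly_cos trig_poly_sin freqs_add freqs_diff)
       (use P Q in auto)
qed

lemma trig_poly_elementary: "trig_poly P \<Longrightarrow> P \<in> elementary"
  by (auto simp: trig_poly_def trig_sum_def[abs_def] intro!: elementary_sum elementary.mult elementary.const hartley_elementary)

lemma trig_poly_measurable: "trig_poly P \<Longrightarrow> P \<in> borel_measurable torus"
  by (intro continuous_measurable_torus elementary_continuous trig_poly_elementary)

section \<open>Uniform and bounded pointwise approximation by trigonometric polynomials\<close>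

definition torus_embed :: "real^2 \<Rightarrow> complex \<times> complex" where
  "torus_embed x = (cis (2 * pi * x $ 1), cis (2 * pi * x $ 2))"

text \<open>\<open>torus_embed\<close> wraps the plane onto a product of two unit circles, whose
  real coordinates are cosines and sines of unit frequency. Linear functionals thus become
  trigonometric polynomials, and sums and products preserve this.\<close>

lemma trig_poly_polynomial:
  "real_polynomial_function p \<Longrightarrow> trig_poly (\<lambda>x. p (torus_embed x))"
proof (induction rule: real_polynomial_function.induct)
  case (linear f)
  interpret bounded_linear f by fact
  have ax: "axis i 1 \<in> freqs" for i
    by (auto simp: freqs_def axis_def)
  have f: "f (z, w) = f (1, 0) * Re z + f (\<i>, 0) * Im z + (f (0, 1) * Re w + f (0, \<i>) * Im w)" for z w
  proof -
    have "(z, w) = Re z *\<^sub>R (1, 0) + Im z *\<^sub>R (\<i>, 0) + (Re w *\<^sub>R (0, 1) + Im w *\<^sub>R (0, \<i>))"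
      by (simp add: complex_eq_iff)
    also have "f \<dots> = Re z *\<^sub>R f (1, 0) + Im z *\<^sub>R f (\<i>, 0) + (Re w *\<^sub>R f (0, 1) + Im w *\<^sub>R f (0, \<i>))"
      by (simp only: add scaleR)
    finally show ?thesis by (simp add: mult.commute)
  qed
  have "trig_poly (\<lambda>x. f (1, 0) * cos (2 * pi * (axis 1 1 \<bullet> x)) + f (\<i>, 0) * sin (2 * pi * (axis 1 1 \<bullet> x))
     + (f (0, 1) * cos (2 * pi * (axis 2 1 \<bullet> x)) + f (0, \<i>) * sin (2 * pi * (axis 2 1 \<bullet> x))))"
    by (intro trig_poly_add trig_poly_cmult trig_poly_cos trig_poly_sin ax)
  then show ?case
    by (simp add: torus_embed_def f[of "cis _"] inner_axis')
qed (auto intro: trig_poly_const trig_poly_add trig_poly_mult)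

text \<open>The arguments differ by an integer, which lies strictly between -1 and 1 because
  \<open>t\<close> is interior. For the two endpoints 0 and 1 the conclusion would fail.\<close>

lemma cis_2pi_eqD:
  assumes "cis (2 * pi * s) = cis (2 * pi * t)" "0 \<le> s" "s \<le> 1" "0 < t" "t < 1"
  shows "s = t"
proof -
  have "sin (2 * pi * s) = sin (2 * pi * t) \<and> cos (2 * pi * s) = cos (2 * pi * t)"
    using assms(1) by (simp add: complex_eq_iff)
  then obtain n :: int where "2 * pi * s = 2 * pi * t + 2 * pi * n"
    unfolding sin_cos_eq_iff by blast
  then have "2 * pi * s = 2 * pi * (t + n)" by (simp add: distrib_left)
  then have st: "s = t + n" by simp
  then have "real_of_int n < 1" "real_of_int n > - 1" using assms by linarith+
  then have "n = 0" by linarith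
  then show ?thesis using st by simp
qed

lemma torus_embed_inj:
  assumes "torus_embed x = torus_embed y" "x \<in> cbox 0 One" "y \<in> box 0 One"
  shows "x = y"
proof -
  have "0 \<le> x $ i" "x $ i \<le> 1" "0 < y $ i" "y $ i < 1" for i
    using assms(2,3) axis_in_Basis_iff[of i "1::real"] by (auto simp: mem_box cart_eq_inner_axis)
  then have "x $ 1 = y $ 1" "x $ 2 = y $ 2"
    using assms(1) cis_2pi_eqD by (auto simp: torus_embed_def)
  then show ?thesis by (simp add: vec_eq_iff forall_2)
qed

text \<open>The embedding glues opposite sides of the square. As it is a quotient map onto its compact
  image, a continuous function vanishing on the boundary factors continuously through it.\<close>

lemma trig_poly_uniform_approx:
  assumes cont: "continuous_on UNIV g" and zero: "\<And>x. x \<notin> box 0 One \<Longrightarrow> g x = 0" and e: "0 < e"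
  shows "\<exists>P. trig_poly P \<and> (\<forall>x\<in>cbox 0 One. \<bar>g x - P x\<bar> < e)"
proof -
  define S where "S = torus_embed ` cbox 0 One"
  define G where "G z = g (inv_into (cbox 0 One) torus_embed z)" for z
  have G: "G (torus_embed x) = g x" if x: "x \<in> cbox 0 One" for x
  proof -
    define y where "y = inv_into (cbox 0 One) torus_embed (torus_embed x)"
    have y: "y \<in> cbox 0 One" "torus_embed y = torus_embed x"
      unfolding y_def using x by (auto intro: inv_into_into f_inv_into_f)
    \<comment> \<open>Points with the same image coincide if one of them is interior; otherwise
      neither is, and \<open>g\<close> is zero at both.\<close>
    have "g y = g x"
    proof (cases "x \<in> box 0 One \<or> y \<in> box 0 One")
      case True
      then show ?thesis using torus_embed_inj[of y x] torus_embed_inj[of x y] x y by auto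
    qed (simp add: zero)
    then show ?thesis by (simp add: G_def y_def)
  qed
  have contE: "continuous_on A torus_embed" for A
    unfolding torus_embed_def by (intro continuous_intros)
  have S: "compact S"
    unfolding S_def by (intro compact_continuous_image contE compact_cbox)
  have "continuous_on S G"
    unfolding continuous_on_closed_vimage[OF compact_imp_closed[OF S]]
  proof (intro allI impI)
    fix B :: "real set" assume "closed B"
    have "G -` B \<inter> S = torus_embed ` (cbox 0 One \<inter> g -` B)"
      using G by (auto simp: S_def)
    also have "compact \<dots>"
    proof (intro compact_continuous_image contE compact_Int_closed compact_cbox)
      show "closed (g -` B)"
        using \<open>closed B\<close> cont by (simp add: closed_vimage continuous_on_eq_continuous_at continuous_at_imp_continuous_on)
    qed
    finally show "closed (G -` B \<inter> S)" by (rule compact_imp_closed)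
  qed
  from Stone_Weierstrass_real_polynomial_function[OF S this e] obtain p where
    p: "real_polynomial_function p" "\<And>z. z \<in> S \<Longrightarrow> \<bar>G z - p z\<bar> < e" by blast
  have "\<bar>g x - p (torus_embed x)\<bar> < e" if "x \<in> cbox 0 One" for x
    using p(2)[of "torus_embed x"] G[OF that] that by (auto simp: S_def)
  then show ?thesis using trig_poly_polynomial[OF p(1)] by blast
qed

lemma AE_torusI:
  assumes "negligible N" "\<And>x. x \<in> cbox 0 One \<Longrightarrow> x \<notin> N \<Longrightarrow> P x"
  shows "AE x in torus. P x"
proof -
  have "AE x in lebesgue. x \<notin> N"
    using assms(1) by (simp add: negligible_iff_null_sets AE_not_in)
  then show ?thesis
    unfolding torus_def by (subst AE_restrict_space_iff) (use assms(2) in auto)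
qed

text \<open>A measurable function is almost everywhere a limit of continuous functions. These are
  clipped at \<open>C\<close>, cut off towards the boundary of the square so that they become
  continuous on the torus, and approximated uniformly. The bound independent of \<open>n\<close>
  permits dominated convergence.\<close>

lemma bounded_trig_poly_approx:
  assumes F: "F \<in> borel_measurable torus" and C: "\<And>x. x \<in> cbox 0 One \<Longrightarrow> \<bar>F x\<bar> \<le> C"
  shows "\<exists>P. (\<forall>n. trig_poly (P n)) \<and> (\<forall>n. \<forall>x\<in>cbox 0 One. \<bar>P n x\<bar> \<le> C + 1)
    \<and> (AE x in torus. (\<lambda>n. P n x) \<longlonglongrightarrow> F x)"
proof -
  have "C \<ge> 0" using C[of 0] by (simp add: mem_box) 
  have "F measurable_on cbox 0 One"
    using F by (simp add: measurable_on_iff_borel_measurable torus_def)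
  then obtain N f where N: "negligible N" and f: "\<And>n. continuous_on UNIV (f n)"
    and lim: "\<And>x. x \<notin> N \<Longrightarrow> (\<lambda>n. f n x) \<longlonglongrightarrow> (if x \<in> cbox 0 One then F x else 0)"
    unfolding measurable_on_def by blast
  \<comment> \<open>Zero off the open square, and equal to 1 from some \<open>n\<close> on at each
    interior point, whose distance to the closed complement is positive.\<close>
  define cut where "cut n x = min 1 (real n * infdist x (- box 0 One))" for n and x :: "real^2"
  define g where "g n x = max (- C) (min C (f n x)) * cut n x" for n x
  have ne: "closed (- box 0 (One :: real^2))" "- box 0 (One :: real^2) \<noteq> {}"
  proof -
    have "0 \<in> - box 0 (One :: real^2)" by (auto simp: mem_box)
    then show "- box 0 (One :: real^2) \<noteq> {}" by blast
  qed (simp add: open_box closed_def)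
  have contg: "continuous_on UNIV (g n)" for n
    unfolding g_def cut_def by (intro continuous_intros f)
  have g0: "g n x = 0" if "x \<notin> box 0 One" for n x
    using that by (simp add: g_def cut_def)
  have cut01: "0 \<le> cut n x" "cut n x \<le> 1" for n x
    by (auto simp: cut_def infdist_nonneg)
  have gC: "\<bar>g n x\<bar> \<le> C" for n x
  proof -
    have "\<bar>g n x\<bar> \<le> C * 1"
      unfolding g_def abs_mult using cut01 \<open>C \<ge> 0\<close> by (intro mult_mono) auto
    then show ?thesis by simp
  qed
  have glim: "(\<lambda>n. g n x) \<longlonglongrightarrow> F x" if x: "x \<in> cbox 0 One" "x \<notin> N \<union> (cbox 0 One - box 0 One)" for x
  proof -
    have "x \<notin> - box 0 One" using x by auto
    then have pos: "infdist x (- box 0 One) > 0"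
      using infdist_pos_not_in_closed[OF ne] by blast
    have "eventually (\<lambda>n. cut n x = 1) sequentially"
    proof -
      obtain n0 :: nat where n0: "1 < real n0 * infdist x (- box 0 One)"
        using ex_less_of_nat_mult[OF pos] by blast
      have "cut n x = 1" if "n \<ge> n0" for n
      proof -
        have "real n0 * infdist x (- box 0 One) \<le> real n * infdist x (- box 0 One)"
          using that pos by (intro mult_right_mono) auto
        then show ?thesis using n0 by (simp add: cut_def)
      qed
      then show ?thesis by (auto simp: eventually_sequentially)
    qed
    then have "(\<lambda>n. cut n x) \<longlonglongrightarrow> 1" by (rule tendsto_eventually)
    moreover have "(\<lambda>n. f n x) \<longlonglongrightarrow> F x" using lim[of x] x by simp
    ultimately have "(\<lambda>n. g n x) \<longlonglongrightarrow> max (- C) (min C (F x)) * 1"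
      unfolding g_def by (intro tendsto_intros)
    moreover have "max (- C) (min C (F x)) = F x" using C[OF x(1)] by auto
    ultimately show ?thesis by simp
  qed
  \<comment> \<open>The error \<open>1 / Suc n\<close> tends to zero and is at most 1, whence the
    bound \<open>C + 1\<close>.\<close>
  have "\<exists>P. trig_poly P \<and> (\<forall>x\<in>cbox 0 One. \<bar>g n x - P x\<bar> < 1 / Suc n)" for n
    by (rule trig_poly_uniform_approx[OF contg g0]) auto
  then obtain P where P: "\<And>n. trig_poly (P n)" "\<And>n x. x \<in> cbox 0 One \<Longrightarrow> \<bar>g n x - P n x\<bar> < 1 / Suc n"
    by metis
  have "\<bar>P n x\<bar> \<le> C + 1" if "x \<in> cbox 0 One" for n x
  proof -
    have "1 / real (Suc n) \<le> 1" by simp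
    then show ?thesis using P(2)[OF that, of n] gC[of n x] by linarith
  qed
  moreover have "AE x in torus. (\<lambda>n. P n x) \<longlonglongrightarrow> F x"
  proof (rule AE_torusI)
    show "negligible (N \<union> (cbox 0 One - box 0 (One :: real^2)))"
      using N by (intro negligible_Un negligible_frontier_interval)
    fix x :: "real^2" assume x: "x \<in> cbox 0 One" "x \<notin> N \<union> (cbox 0 One - box 0 One)"
    have "(\<lambda>n. g n x - P n x) \<longlonglongrightarrow> 0"
    proof (rule Lim_null_comparison)
      show "eventually (\<lambda>n. norm (g n x - P n x) \<le> 1 / Suc n) sequentially"
        using P(2)[OF x(1)] by (simp add: less_imp_le)
      show "(\<lambda>n. 1 / real (Suc n)) \<longlonglongrightarrow> 0"
        using LIMSEQ_inverse_real_of_nat by (simp add: inverse_eq_divide)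
    qed
    from tendsto_diff[OF glim[OF x] this] show "(\<lambda>n. P n x) \<longlonglongrightarrow> F x" by simp
  qed
  ultimately show ?thesis using P(1) by blast
qed

section \<open>Uniqueness of Hartley coefficients and density in L2\<close>

lemma AE_space_torus: "AE x in torus. x \<in> cbox 0 One"
  using AE_space[of torus] by (simp add: space_torus)

lemma trig_poly_bounded: "trig_poly P \<Longrightarrow> \<exists>C. \<forall>x. \<bar>P x\<bar> \<le> C"
proof -
  assume "trig_poly P"
  then obtain A c where P: "finite A" "P = trig_sum A c" by (auto simp: trig_poly_def)
  have "\<bar>P x\<bar> \<le> (\<Sum>k\<in>A. \<bar>c k\<bar> * 2)" for x
    unfolding P(2) trig_sum_def
    by (rule order_trans[OF sum_abs]) (auto simp: abs_mult intro!: sum_mono mult_left_mono hartley_bound)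
  then show ?thesis by blast
qed

lemma trig_poly_square_integrable: "trig_poly P \<Longrightarrow> square_integrable torus P"
  using trig_poly_bounded square_integrable_bounded[OF finite_measure_torus trig_poly_measurable] by blast

text \<open>Trigonometric polynomials, to which \<open>h\<close> is orthogonal, approximate
  \<open>sgn (h x)\<close> boundedly; in the limit the integral of \<open>\<bar>h x\<bar>\<close> is
  zero. Integrability is all that \<open>has_weak_gradient\<close> offers where this is
  applied.\<close>

lemma hartley_coefficients_unique:
  assumes h: "integrable torus h" and zero: "\<And>k. k \<in> freqs \<Longrightarrow> (\<integral>x. h x * hartley k x \<partial>torus) = 0"
  shows "AE x in torus. h x = 0"
proof -
  have [measurable]: "h \<in> borel_measurable torus" using h by simp
  have meas_sgn: "(\<lambda>x. sgn (h x)) \<in> borel_measurable torus" by measurable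
  obtain P where P: "\<And>n. trig_poly (P n)" "\<And>n x. x \<in> cbox 0 One \<Longrightarrow> \<bar>P n x\<bar> \<le> 1 + 1"
    "AE x in torus. (\<lambda>n. P n x) \<longlonglongrightarrow> sgn (h x)"
    using bounded_trig_poly_approx[OF meas_sgn, of 1] by (auto simp: abs_sgn_eq)
  have [measurable]: "P n \<in> borel_measurable torus" for n by (rule trig_poly_measurable[OF P(1)])
  have "(\<integral>x. h x * P n x \<partial>torus) = 0" for n
  proof -
    obtain A c where A: "A \<subseteq> freqs" "P n = trig_sum A c" using P(1)[of n] by (auto simp: trig_poly_def)
    have "(\<integral>x. h x * P n x \<partial>torus) = (\<integral>x. (\<Sum>k\<in>A. c k * (h x * hartley k x)) \<partial>torus)"
      by (simp add: A trig_sum_def sum_distrib_left mult_ac)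
    also have "\<dots> = (\<Sum>k\<in>A. c k * (\<integral>x. h x * hartley k x \<partial>torus))"
      by (subst Bochner_Integration.integral_sum)
         (auto intro!: integrable_mult_bounded[OF h hartley_measurable hartley_bound])
    also have "\<dots> = 0" using zero A by (intro sum.neutral) auto
    finally show ?thesis .
  qed
  moreover have "(\<lambda>n. \<integral>x. h x * P n x \<partial>torus) \<longlonglongrightarrow> (\<integral>x. h x * sgn (h x) \<partial>torus)"
  proof (rule integral_dominated_convergence[where w = "\<lambda>x. 2 * \<bar>h x\<bar>"])
    show "AE x in torus. (\<lambda>n. h x * P n x) \<longlonglongrightarrow> h x * sgn (h x)"
      using P(3) by eventually_elim (intro tendsto_intros)
    show "AE x in torus. norm (h x * P n x) \<le> 2 * \<bar>h x\<bar>" for n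
      using AE_space_torus
    proof eventually_elim
      case (elim x)
      then show ?case
        using mult_left_mono[OF P(2)[of x n], of "\<bar>h x\<bar>"] by (simp add: abs_mult)
    qed
  qed (use h in auto)
  ultimately have "(\<integral>x. h x * sgn (h x) \<partial>torus) = 0" by (simp add: LIMSEQ_const_iff)
  then have "(\<integral>x. \<bar>h x\<bar> \<partial>torus) = 0" by (simp add: abs_sgn)
  then show ?thesis using integral_nonneg_eq_0_iff_AE[of torus "\<lambda>x. \<bar>h x\<bar>"] h by simp
qed

text \<open>Truncation at height \<open>n\<close> reduces to bounded functions, for which bounded
  pointwise approximation is approximation in L2 by dominated convergence.\<close>

lemma trig_poly_L2_dense:
  assumes F: "square_integrable torus F" and e: "0 < e"
  shows "\<exists>P. trig_poly P \<and> (\<integral>x. (F x - P x)\<^sup>2 \<partial>torus) < e"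
proof -
  have [measurable]: "F \<in> borel_measurable torus" using F by (simp add: square_integrable_def)
  define T where "T n x = max (- real n) (min (real n) (F x))" for n x
  have [measurable]: "T n \<in> borel_measurable torus" for n unfolding T_def by measurable
  have Tn: "\<bar>T n x\<bar> \<le> n" for n x by (auto simp: T_def)
  have T_sq: "square_integrable torus (T n)" for n
    by (rule square_integrable_bounded[OF finite_measure_torus _ Tn]) simp
  have "(\<lambda>n. \<integral>x. (F x - T n x)\<^sup>2 \<partial>torus) \<longlonglongrightarrow> (\<integral>x. 0 \<partial>torus)"
  proof (rule integral_dominated_convergence[where w = "\<lambda>x. (F x)\<^sup>2"])
    show "AE x in torus. norm ((F x - T n x)\<^sup>2) \<le> (F x)\<^sup>2" for n
    proof (rule AE_I2)
      fix x
      have "\<bar>F x - T n x\<bar> \<le> \<bar>F x\<bar>" by (auto simp: T_def)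
      then show "norm ((F x - T n x)\<^sup>2) \<le> (F x)\<^sup>2" by (simp add: abs_le_square_iff)
    qed
    show "AE x in torus. (\<lambda>n. (F x - T n x)\<^sup>2) \<longlonglongrightarrow> 0"
    proof (rule AE_I2)
      fix x
      obtain n0 :: nat where "\<bar>F x\<bar> \<le> n0" using real_arch_simple by blast
      then have "F x - T n x = 0" if "n \<ge> n0" for n using that by (auto simp: T_def)
      then show "(\<lambda>n. (F x - T n x)\<^sup>2) \<longlonglongrightarrow> 0"
        by (intro tendsto_eventually) (auto simp: eventually_sequentially)
    qed
  qed (use F in \<open>auto simp: square_integrable_def\<close>)
  \<comment> \<open>\<open>e / 4\<close>, because both errors are doubled in the inequality for the
    square of a sum below.\<close>
  then have "eventually (\<lambda>n. (\<integral>x. (F x - T n x)\<^sup>2 \<partial>torus) < e / 4) sequentially"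
    using e by (intro order_tendstoD) auto
  then obtain n where n: "(\<integral>x. (F x - T n x)\<^sup>2 \<partial>torus) < e / 4"
    using eventually_happens by force
  obtain P where P: "\<And>j. trig_poly (P j)" "\<And>j x. x \<in> cbox 0 One \<Longrightarrow> \<bar>P j x\<bar> \<le> real n + 1"
    "AE x in torus. (\<lambda>j. P j x) \<longlonglongrightarrow> T n x"
    using bounded_trig_poly_approx[of "T n" "real n"] Tn \<open>T n \<in> borel_measurable torus\<close> by blast
  have [measurable]: "P j \<in> borel_measurable torus" for j by (rule trig_poly_measurable[OF P(1)])
  have "(\<lambda>j. \<integral>x. (T n x - P j x)\<^sup>2 \<partial>torus) \<longlonglongrightarrow> (\<integral>x. 0 \<partial>torus)"
  proof (rule integral_dominated_convergence[where w = "\<lambda>x. (2 * real n + 1)\<^sup>2"])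
    show "AE x in torus. norm ((T n x - P j x)\<^sup>2) \<le> (2 * real n + 1)\<^sup>2" for j
      using AE_space_torus
    proof eventually_elim
      case (elim x)
      have "\<bar>T n x - P j x\<bar> \<le> 2 * real n + 1" using P(2)[OF elim, of j] Tn[of n x] by linarith
      from power_mono[OF this abs_ge_zero, of 2] show ?case by simp
    qed
    show "AE x in torus. (\<lambda>j. (T n x - P j x)\<^sup>2) \<longlonglongrightarrow> 0"
      using P(3) by eventually_elim (auto intro!: tendsto_eq_intros)
    show "integrable torus (\<lambda>x. (2 * real n + 1)\<^sup>2)"
      by (rule finite_measure.integrable_const[OF finite_measure_torus])
  qed auto
  then have "eventually (\<lambda>j. (\<integral>x. (T n x - P j x)\<^sup>2 \<partial>torus) < e / 4) sequentially"
    using e by (intro order_tendstoD) auto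
  then obtain j where j: "(\<integral>x. (T n x - P j x)\<^sup>2 \<partial>torus) < e / 4"
    using eventually_happens by force
  note sq = square_integrable_power2[OF square_integrable_diff[OF F T_sq, of n]]
    square_integrable_power2[OF square_integrable_diff[OF T_sq trig_poly_square_integrable[OF P(1)], of n j]]
    square_integrable_power2[OF square_integrable_diff[OF F trig_poly_square_integrable[OF P(1)], of j]]
  have "(\<integral>x. (F x - P j x)\<^sup>2 \<partial>torus) \<le> (\<integral>x. 2 * (F x - T n x)\<^sup>2 + 2 * (T n x - P j x)\<^sup>2 \<partial>torus)"
  proof (rule integral_mono)
    fix x
    have "(a + b)\<^sup>2 \<le> 2 * a\<^sup>2 + 2 * b\<^sup>2" for a b :: real
      using sum_squares_bound[of a b] by (simp add: power2_sum)
    from this[of "F x - T n x" "T n x - P j x"]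
    show "(F x - P j x)\<^sup>2 \<le> 2 * (F x - T n x)\<^sup>2 + 2 * (T n x - P j x)\<^sup>2" by simp
  qed (use sq in auto)
  also have "\<dots> = 2 * (\<integral>x. (F x - T n x)\<^sup>2 \<partial>torus) + 2 * (\<integral>x. (T n x - P j x)\<^sup>2 \<partial>torus)"
    using sq by simp
  also have "\<dots> < e" using n j by simp
  finally show ?thesis using P(1) by blast
qed

section \<open>Fourier partial sums and weak gradients\<close>

text \<open>The Fourier partial sum; for finite \<open>A \<subseteq> freqs\<close> and square
  integrable \<open>F\<close> it is the orthogonal projection in L2 onto the span of the
  \<open>hartley k\<close> with \<open>k \<in> A\<close>.\<close>

definition hartley_sum :: "(real^2) set \<Rightarrow> (real^2 \<Rightarrow> real) \<Rightarrow> real^2 \<Rightarrow> real" where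
  "hartley_sum A F = trig_sum A (\<lambda>k. \<integral>x. F x * hartley k x \<partial>torus)"

lemma trig_poly_trig_sum: "finite A \<Longrightarrow> A \<subseteq> freqs \<Longrightarrow> trig_poly (trig_sum A c)"
  by (auto simp: trig_poly_def)

lemma trig_sum_periodic:
  assumes "A \<subseteq> freqs" shows "Z2_periodic (trig_sum A c)"
  unfolding Z2_periodic_def trig_sum_def
proof (intro allI sum.cong refl)
  fix x i k assume "k \<in> A"
  then have "Z2_periodic (hartley k)" using assms by (auto intro: hartley_periodic)
  then show "c k * hartley k (x + axis i 1) = c k * hartley k x" by (simp add: Z2_periodic_def)
qed

text \<open>Orthonormality removes the mixed terms of the expanded square. Each coefficient then
  enters through a summand of its own and can be optimised separately.\<close>

lemma trig_sum_L2_distance: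
  assumes A: "finite A" "A \<subseteq> freqs" and F: "square_integrable torus F"
  shows "(\<integral>x. (F x - trig_sum A c x)\<^sup>2 \<partial>torus) =
    (\<integral>x. (F x)\<^sup>2 \<partial>torus) + (\<Sum>k\<in>A. (c k)\<^sup>2 - 2 * c k * (\<integral>x. F x * hartley k x \<partial>torus))"
proof -
  let ?P = "trig_sum A c"
  have P: "square_integrable torus ?P"
    by (intro trig_poly_square_integrable trig_poly_trig_sum A)
  have FP: "(\<integral>x. F x * ?P x \<partial>torus) = (\<Sum>k\<in>A. c k * (\<integral>x. F x * hartley k x \<partial>torus))"
  proof -
    have "(\<integral>x. F x * ?P x \<partial>torus) = (\<integral>x. (\<Sum>k\<in>A. c k * (F x * hartley k x)) \<partial>torus)"
      by (simp add: trig_sum_def sum_distrib_left mult_ac)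
    also have "\<dots> = (\<Sum>k\<in>A. c k * (\<integral>x. F x * hartley k x \<partial>torus))"
      by (subst Bochner_Integration.integral_sum)
         (auto intro!: square_integrable_mult_integrable F hartley_square_integrable)
    finally show ?thesis .
  qed
  have PP: "(\<integral>x. (?P x)\<^sup>2 \<partial>torus) = (\<Sum>k\<in>A. (c k)\<^sup>2)"
  proof -
    have int: "integrable torus (\<lambda>x. c k * c l * (hartley k x * hartley l x))" for k l
      by (intro integrable_mult_right square_integrable_mult_integrable hartley_square_integrable)
    have "(\<integral>x. (?P x)\<^sup>2 \<partial>torus) = (\<integral>x. (\<Sum>k\<in>A. \<Sum>l\<in>A. c k * c l * (hartley k x * hartley l x)) \<partial>torus)"
      by (simp add: trig_sum_def power2_eq_square sum_product mult_ac)
    also have "\<dots> = (\<Sum>k\<in>A. \<Sum>l\<in>A. c k * c l * (\<integral>x. hartley k x * hartley l x \<partial>torus))"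
      using int by (simp add: Bochner_Integration.integral_sum)
    also have "\<dots> = (\<Sum>k\<in>A. \<Sum>l\<in>A. if k = l then c k * c l else 0)"
      using A(2) by (intro sum.cong refl) (auto simp: hartley_orthonormal subset_iff)
    also have "\<dots> = (\<Sum>k\<in>A. (c k)\<^sup>2)"
      using A(1) by (simp add: power2_eq_square)
    finally show ?thesis .
  qed
  have "(\<integral>x. (F x - ?P x)\<^sup>2 \<partial>torus) = (\<integral>x. (F x)\<^sup>2 + (?P x)\<^sup>2 - 2 * (F x * ?P x) \<partial>torus)"
    by (simp add: power2_diff mult.assoc)
  also have "\<dots> = (\<integral>x. (F x)\<^sup>2 \<partial>torus) + (\<integral>x. (?P x)\<^sup>2 \<partial>torus) - 2 * (\<integral>x. F x * ?P x \<partial>torus)"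
    using square_integrable_power2[OF F] square_integrable_power2[OF P]
      square_integrable_mult_integrable[OF F P] by simp
  finally show ?thesis
    by (simp add: FP PP sum_subtractf sum_distrib_left mult.assoc)
qed

text \<open>Completing the square in each summand: \<open>s\<^sup>2 - 2 * s * a\<close> is minimal
  at \<open>s = a\<close>.\<close>

lemma hartley_sum_best_approx:
  assumes A: "finite A" "A \<subseteq> freqs" and F: "square_integrable torus F"
  shows "(\<integral>x. (F x - hartley_sum A F x)\<^sup>2 \<partial>torus) \<le> (\<integral>x. (F x - trig_sum A c x)\<^sup>2 \<partial>torus)"
  unfolding hartley_sum_def trig_sum_L2_distance[OF assms]
proof (intro add_left_mono sum_mono)
  fix k
  define a where "a = (\<integral>x. F x * hartley k x \<partial>torus)"
  have "0 \<le> (c k - a)\<^sup>2" by simp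
  then show "a\<^sup>2 - 2 * a * a \<le> (c k)\<^sup>2 - 2 * c k * a"
    by (simp add: power2_eq_square algebra_simps)
qed

text \<open>Only frequency sets invariant under \<open>k \<mapsto> -k\<close> make the partial sums commute with derivatives.\<close>

lemma hartley_sum_L2_approx:
  assumes fin: "finite \<F>" and sq: "\<And>F. F \<in> \<F> \<Longrightarrow> square_integrable torus F" and e: "0 < e"
  shows "\<exists>A. finite A \<and> A \<subseteq> freqs \<and> uminus ` A = A \<and>
    (\<forall>F\<in>\<F>. (\<integral>x. (F x - hartley_sum A F x)\<^sup>2 \<partial>torus) < e)"
proof -
  have ex: "\<exists>A. finite A \<and> A \<subseteq> freqs \<and> (\<exists>c. (\<integral>x. (F x - trig_sum A c x)\<^sup>2 \<partial>torus) < e)"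
    if "F \<in> \<F>" for F
    using trig_poly_L2_dense[OF sq[OF that] e] by (auto simp: trig_poly_def)
  from bchoice[OF ballI[OF ex]] obtain A where A: "\<forall>F\<in>\<F>. finite (A F) \<and> A F \<subseteq> freqs \<and>
      (\<exists>c. (\<integral>x. (F x - trig_sum (A F) c x)\<^sup>2 \<partial>torus) < e)" ..
  have A': "finite (A F)" "A F \<subseteq> freqs" if "F \<in> \<F>" for F
    using A that by auto
  \<comment> \<open>A single symmetric set for the whole family. Enlarging is harmless, since the
    projection for \<open>U\<close> is at least as close as any sum over \<open>A F\<close>.\<close>
  define U where "U = (\<Union>F\<in>\<F>. A F) \<union> uminus ` (\<Union>F\<in>\<F>. A F)"
  have U: "finite U" "U \<subseteq> freqs" "uminus ` U = U"
    using A' fin freqs_minus by (auto simp: U_def image_Un image_image subset_iff)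
  have "(\<integral>x. (F x - hartley_sum U F x)\<^sup>2 \<partial>torus) < e" if F: "F \<in> \<F>" for F
  proof -
    obtain c where c: "(\<integral>x. (F x - trig_sum (A F) c x)\<^sup>2 \<partial>torus) < e"
      using A F by auto
    have "A F \<subseteq> U" using F by (auto simp: U_def)
    note eq = trig_sum_superset[OF U(1) this, of c]
    show ?thesis
      by (rule order_le_less_trans[OF hartley_sum_best_approx[OF U(1,2) sq[OF F]] c[unfolded eq]])
  qed
  then show ?thesis using U by blast
qed

lemma partial_trig_sum:
  "partial i (trig_sum A c) x = (\<Sum>k\<in>A. c k * (2 * pi * k $ i * hartley (- k) x))"
proof -
  have "\<exists>D. (hartley k has_derivative D) (at x) \<and> D (axis i 1) = 2 * pi * k $ i * hartley (- k) x" for k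
    using has_derivative_partial[OF elementary_differentiable[OF hartley_elementary[of k]], of x]
    by (metis partial_hartley)
  then obtain D where D: "\<And>k. (hartley k has_derivative D k) (at x)"
    "\<And>k. D k (axis i 1) = 2 * pi * k $ i * hartley (- k) x" by metis
  have "(trig_sum A c has_derivative (\<lambda>h. \<Sum>k\<in>A. c k * D k h)) (at x)"
    unfolding trig_sum_def[abs_def] by (intro has_derivative_sum has_derivative_mult_right D)
  from partial_eqI[OF this] D(2) show ?thesis by simp
qed

text \<open>Hartley functions are test functions, so the definition of the weak gradient applies;
  \<open>partial_hartley\<close> turns \<open>k\<close> into \<open>- k\<close>.\<close>

lemma weak_gradient_coefficient:
  assumes "has_weak_gradient f G" "k \<in> freqs"
  shows "(\<integral>x. G x $ i * hartley k x \<partial>torus) = - (2 * pi * k $ i) * (\<integral>x. f x * hartley (- k) x \<partial>torus)"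
proof -
  have "(\<integral>x. G x $ i * hartley k x \<partial>torus) = - (\<integral>x. f x * partial i (hartley k) x \<partial>torus)"
    using assms hartley_test[OF assms(2)] by (simp add: has_weak_gradient_def)
  also have "\<dots> = - (\<integral>x. (2 * pi * k $ i) * (f x * hartley (- k) x) \<partial>torus)"
    by (simp add: partial_hartley mult_ac)
  finally show ?thesis by (simp only: integral_mult_right_zero mult_minus_left)
qed

text \<open>Differentiation swaps \<open>k\<close> and \<open>- k\<close>, and a symmetric
  \<open>A\<close> absorbs the swap. Gradients of partial sums are thus themselves projections of
  the weak gradient, and converge in L2 along with them.\<close>

lemma partial_hartley_sum:
  assumes G: "has_weak_gradient f G" and A: "A \<subseteq> freqs" "uminus ` A = A"
  shows "partial i (hartley_sum A f) x = hartley_sum A (\<lambda>x. G x $ i) x"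
proof -
  have inA: "- k \<in> A" if "k \<in> A" for k using that A(2) by blast
  have "hartley_sum A (\<lambda>x. G x $ i) x =
      (\<Sum>k\<in>A. (- (2 * pi * k $ i) * (\<integral>x. f x * hartley (- k) x \<partial>torus)) * hartley k x)"
    unfolding hartley_sum_def trig_sum_def
    using A(1) by (intro sum.cong refl) (auto simp only: weak_gradient_coefficient[OF G] subset_iff)
  \<comment> \<open>Substituting \<open>- k\<close> for \<open>k\<close> cancels the minus sign from
    integration by parts.\<close>
  also have "\<dots> = (\<Sum>k\<in>A. (\<integral>x. f x * hartley k x \<partial>torus) * (2 * pi * k $ i * hartley (- k) x))"
    by (rule sum.reindex_bij_witness[of _ uminus uminus]) (auto simp: inA)
  finally show ?thesis by (simp add: hartley_sum_def partial_trig_sum)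
qed

section \<open>Integrability from \<open>Lp_space\<close>, and uniqueness of weak gradients\<close>

lemma Lp_space_measurable: "f \<in> Lp_space p \<Longrightarrow> f \<in> borel_measurable torus"
  by (simp add: Lp_space_def)

lemma Lp_space_integrable_powr:
  assumes "f \<in> Lp_space p" "p \<noteq> \<infinity>"
  shows "integrable torus (\<lambda>x. \<bar>f x\<bar> powr enn2real p)"
proof -
  have [measurable]: "f \<in> borel_measurable torus" using assms(1) by (rule Lp_space_measurable)
  have "(\<integral>\<^sup>+ x. ennreal (\<bar>f x\<bar> powr enn2real p) \<partial>torus) \<noteq> \<infinity>"
    using assms by (auto simp: Lp_space_def Lp_norm_def Let_def)
  then show ?thesis by (intro integrableI_bounded) (auto simp: less_top)
qed

lemma Lp_space_1_integrable:
  assumes "f \<in> Lp_space 1" shows "integrable torus f"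
proof (rule integrable_abs_cancel)
  show "integrable torus (\<lambda>x. \<bar>f x\<bar>)"
    using Lp_space_integrable_powr[OF assms] by simp
qed (rule Lp_space_measurable[OF assms])

lemma Lp_space_2_square_integrable: "f \<in> Lp_space 2 \<Longrightarrow> square_integrable torus f"
  using Lp_space_integrable_powr[of f 2] Lp_space_measurable[of f 2]
  by (simp add: square_integrable_def)

text \<open>On a finite measure space \<open>y\<^sup>2 \<le> 1 + y ^ 4\<close> is enough; it follows
  from \<open>(y\<^sup>2 - 1)\<^sup>2 \<ge> 0\<close>.\<close>

lemma Lp_space_4_square_integrable:
  assumes "f \<in> Lp_space 4" shows "square_integrable torus f"
  unfolding square_integrable_def
proof
  show [measurable]: "f \<in> borel_measurable torus" using assms by (rule Lp_space_measurable)
  have "integrable torus (\<lambda>x. \<bar>f x\<bar> ^ 4)"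
    using Lp_space_integrable_powr[OF assms] by simp
  then have "integrable torus (\<lambda>x. 1 + \<bar>f x\<bar> ^ 4)"
    by (intro Bochner_Integration.integrable_add finite_measure.integrable_const[OF finite_measure_torus])
  then show "integrable torus (\<lambda>x. (f x)\<^sup>2)"
  proof (rule Bochner_Integration.integrable_bound)
    have "y\<^sup>2 \<le> 1 + y ^ 4" for y :: real
    proof -
      have "2 * y\<^sup>2 \<le> y ^ 4 + 1"
        using zero_le_power2[of "y\<^sup>2 - 1"] by (simp add: power2_diff)
      then show ?thesis using zero_le_power2[of y] by linarith
    qed
    from this[of "\<bar>f _\<bar>"] show "AE x in torus. norm ((f x)\<^sup>2) \<le> norm (1 + \<bar>f x\<bar> ^ 4)"
      by (intro AE_I2) simp
  qed measurable
qed

text \<open>Both gradients have the same Hartley coefficients. The equation and the Sobolev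
  condition each bring a gradient of their own, and L4 bounds are given only for the second.\<close>

lemma weak_gradient_unique:
  assumes G: "has_weak_gradient f G" and H: "has_weak_gradient f H"
  shows "AE x in torus. G x = H x"
proof -
  have "AE x in torus. G x $ i - H x $ i = 0" for i
  proof (rule hartley_coefficients_unique)
    have int: "integrable torus (\<lambda>x. G x $ i)" "integrable torus (\<lambda>x. H x $ i)"
      using G H by (auto simp: has_weak_gradient_def intro: Lp_space_1_integrable)
    then show "integrable torus (\<lambda>x. G x $ i - H x $ i)" by simp
    fix k assume k: "k \<in> freqs"
    have "(\<integral>x. (G x $ i - H x $ i) * hartley k x \<partial>torus) =
        (\<integral>x. G x $ i * hartley k x \<partial>torus) - (\<integral>x. H x $ i * hartley k x \<partial>torus)"
      unfolding left_diff_distrib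
      by (intro Bochner_Integration.integral_diff integrable_mult_bounded[OF _ hartley_measurable hartley_bound] int)
    then show "(\<integral>x. (G x $ i - H x $ i) * hartley k x \<partial>torus) = 0"
      using weak_gradient_coefficient[OF G k] weak_gradient_coefficient[OF H k] by simp
  qed
  from this[of 1] this[of 2] show ?thesis
    by eventually_elim (simp add: vec_eq_iff forall_2)
qed

section \<open>Orthogonality of the transport term to functions of the solution\<close>

text \<open>Testing the divergence with \<open>sin (t P + a) / t\<close>, where \<open>P\<close> is a partial Fourier sum of \<open>\<phi>\<close>,
  and letting the partial sums converge.\<close>

lemma transport_orthogonal_cos:
  assumes \<phi>: "square_integrable torus \<phi>" and G: "has_weak_gradient \<phi> G"
    and G2: "\<And>i. square_integrable torus (\<lambda>x. G x $ i)"
    and u: "\<And>i. square_integrable torus (\<lambda>x. u x $ i)"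
    and div: "weakly_divergence_free u" and t: "t \<noteq> 0"
  shows "(\<integral>x. (u x \<bullet> G x) * cos (t * \<phi> x + a) \<partial>torus) = 0"
proof -
  \<comment> \<open>One frequency set has to serve the function and both components of its gradient,
    so that the partial sums stay related by differentiation.\<close>
  define \<F> where "\<F> = {\<phi>, \<lambda>x. G x $ 1, \<lambda>x. G x $ 2}"
  have ex: "\<exists>A. finite A \<and> A \<subseteq> freqs \<and> uminus ` A = A \<and>
    (\<forall>F\<in>\<F>. (\<integral>x. (F x - hartley_sum A F x)\<^sup>2 \<partial>torus) < 1 / Suc n)" for n
    using \<phi> G2 by (intro hartley_sum_L2_approx) (auto simp: \<F>_def)
  from choice[OF allI[OF ex]] obtain A where all_A: "\<forall>n. finite (A n) \<and> A n \<subseteq> freqs \<and> uminus ` A n = A n \<and>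
    (\<forall>F\<in>\<F>. (\<integral>x. (F x - hartley_sum (A n) F x)\<^sup>2 \<partial>torus) < 1 / Suc n)" ..
  have A: "finite (A n)" "A n \<subseteq> freqs" "uminus ` A n = A n" for n
    using all_A by auto
  have approx: "(\<integral>x. (F x - hartley_sum (A n) F x)\<^sup>2 \<partial>torus) < 1 / Suc n" if "F \<in> \<F>" for F n
    using all_A that by blast
  have lim: "(\<lambda>n. \<integral>x. (F x - hartley_sum (A n) F x)\<^sup>2 \<partial>torus) \<longlonglongrightarrow> 0" if "F \<in> \<F>" for F
  proof (rule tendsto_sandwich[OF _ _ tendsto_const])
    show "(\<lambda>n. 1 / real (Suc n)) \<longlonglongrightarrow> 0"
      using LIMSEQ_inverse_real_of_nat by (simp add: inverse_eq_divide)
    show "eventually (\<lambda>n. (\<integral>x. (F x - hartley_sum (A n) F x)\<^sup>2 \<partial>torus) \<le> 1 / real (Suc n)) sequentially"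
      using approx[OF that] by (intro always_eventually allI less_imp_le)
  qed simp
  have poly: "trig_poly (hartley_sum (A n) F)" for n F
    unfolding hartley_sum_def by (intro trig_poly_trig_sum A)
  have sq: "square_integrable torus (\<lambda>x. F x - hartley_sum (A n) F x)" if "square_integrable torus F" for F n
    by (intro square_integrable_diff that trig_poly_square_integrable poly)
  define P where "P n = hartley_sum (A n) \<phi>" for n
  define \<Gamma> where "\<Gamma> i n = hartley_sum (A n) (\<lambda>x. G x $ i)" for i n
  have [measurable]: "P n \<in> borel_measurable torus" "\<Gamma> i n \<in> borel_measurable torus" for i n
    unfolding P_def \<Gamma>_def by (intro trig_poly_measurable poly)+
  have [measurable]: "\<phi> \<in> borel_measurable torus" using \<phi> by (simp add: square_integrable_def)
  \<comment> \<open>Almost everywhere convergence is used to pass to the limit inside the cosine, L2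
    convergence for the gradients.\<close>
  obtain r where r: "strict_mono r" "AE x in torus. (\<lambda>n. \<phi> x - P (r n) x) \<longlonglongrightarrow> 0"
    using tendsto_L2_AE_subseq[OF finite_measure_torus sq[OF \<phi>] lim[of \<phi>]] by (auto simp: \<F>_def P_def)
  define b where "b n x = cos (t * P (r n) x + a)" for n x
  define \<beta> where "\<beta> x = cos (t * \<phi> x + a)" for x
  have meas_b [measurable]: "b n \<in> borel_measurable torus" "\<beta> \<in> borel_measurable torus" for n
    unfolding b_def \<beta>_def by measurable
  have b1: "\<bar>b n x\<bar> \<le> 1" for n x by (simp add: b_def)
  have b_lim: "AE x in torus. (\<lambda>n. b n x) \<longlonglongrightarrow> \<beta> x"
    using r(2)
  proof eventually_elim
    case (elim x)
    from tendsto_diff[OF tendsto_const[of "\<phi> x"] elim] have "(\<lambda>n. P (r n) x) \<longlonglongrightarrow> \<phi> x" by simp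
    then show ?case unfolding b_def \<beta>_def by (intro tendsto_intros)
  qed
  have inF: "(\<lambda>x. G x $ i) \<in> \<F>" for i
    using exhaust_2[of i] by (auto simp: \<F>_def)
  have \<Gamma>_sq: "square_integrable torus (\<Gamma> i n)" for i n
    unfolding \<Gamma>_def by (intro trig_poly_square_integrable poly)
  have int_b\<Gamma>: "integrable torus (\<lambda>x. u x $ i * (b n x * \<Gamma> i m x))" for i n m
    by (intro square_integrable_mult_integrable u square_integrable_mult_bounded \<Gamma>_sq meas_b b1)
  have int_bG: "integrable torus (\<lambda>x. u x $ i * (b n x * G x $ i))" for i n
    by (intro square_integrable_mult_integrable u square_integrable_mult_bounded G2 meas_b b1)
  have int_uG: "integrable torus (\<lambda>x. u x $ i * G x $ i)" for i
    by (intro square_integrable_mult_integrable u G2)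
  have comp_lim: "(\<lambda>n. \<integral>x. u x $ i * (b n x * \<Gamma> i (r n) x) \<partial>torus) \<longlonglongrightarrow> (\<integral>x. u x $ i * G x $ i * \<beta> x \<partial>torus)" for i
  proof -
    \<comment> \<open>The error of replacing the gradient of the partial sum by the weak one
      vanishes by Cauchy-Schwarz, uniformly in the bounded cosine.\<close>
    have "(\<lambda>n. \<integral>x. u x $ i * (b n x * (G x $ i - \<Gamma> i (r n) x)) \<partial>torus) \<longlonglongrightarrow> 0"
    proof (rule integral_mult_tendsto_zero[OF u])
      show "square_integrable torus (\<lambda>x. G x $ i - \<Gamma> i (r n) x)" for n
        unfolding \<Gamma>_def by (rule sq[OF G2])
      show "(\<lambda>n. \<integral>x. (G x $ i - \<Gamma> i (r n) x)\<^sup>2 \<partial>torus) \<longlonglongrightarrow> 0"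
        using LIMSEQ_subseq_LIMSEQ[OF lim[OF inF] r(1)] by (simp add: \<Gamma>_def o_def)
    qed (use b1 in auto)
    \<comment> \<open>Now only the cosine depends on \<open>n\<close>, and
      \<open>u x $ i * G x $ i\<close> is an integrable majorant up to sign.\<close>
    moreover have "(\<lambda>n. \<integral>x. u x $ i * (b n x * G x $ i) \<partial>torus) \<longlonglongrightarrow> (\<integral>x. u x $ i * G x $ i * \<beta> x \<partial>torus)"
    proof (rule integral_dominated_convergence[where w = "\<lambda>x. \<bar>u x $ i * G x $ i\<bar>"])
      show "AE x in torus. (\<lambda>n. u x $ i * (b n x * G x $ i)) \<longlonglongrightarrow> u x $ i * G x $ i * \<beta> x"
        using b_lim by eventually_elim (auto intro!: tendsto_eq_intros)
      show "AE x in torus. norm (u x $ i * (b n x * G x $ i)) \<le> \<bar>u x $ i * G x $ i\<bar>" for n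
      proof (rule AE_I2)
        fix x
        show "norm (u x $ i * (b n x * G x $ i)) \<le> \<bar>u x $ i * G x $ i\<bar>"
          using mult_left_mono[OF b1[of n x], of "\<bar>u x $ i * G x $ i\<bar>"] by (simp add: abs_mult mult_ac)
      qed
      show "(\<lambda>x. u x $ i * G x $ i * \<beta> x) \<in> borel_measurable torus"
        using borel_measurable_integrable[OF int_uG] by measurable
    qed (use int_uG int_bG in auto)
    ultimately have "(\<lambda>n. (\<integral>x. u x $ i * (b n x * G x $ i) \<partial>torus) - (\<integral>x. u x $ i * (b n x * (G x $ i - \<Gamma> i (r n) x)) \<partial>torus))
        \<longlonglongrightarrow> (\<integral>x. u x $ i * G x $ i * \<beta> x \<partial>torus) - 0"
      by (intro tendsto_diff)
    moreover have "(\<integral>x. u x $ i * (b n x * G x $ i) \<partial>torus) - (\<integral>x. u x $ i * (b n x * (G x $ i - \<Gamma> i (r n) x)) \<partial>torus)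
        = (\<integral>x. u x $ i * (b n x * \<Gamma> i (r n) x) \<partial>torus)" for n
      using int_bG[of i n] int_b\<Gamma>[of i n "r n"] by (simp add: right_diff_distrib)
    ultimately show ?thesis by simp
  qed
  have zero: "(\<integral>x. u x $ 1 * (b n x * \<Gamma> 1 (r n) x) \<partial>torus) + (\<integral>x. u x $ 2 * (b n x * \<Gamma> 2 (r n) x) \<partial>torus) = 0" for n
  proof -
    \<comment> \<open>The test function is not divided by \<open>t\<close>; its gradient carries a
      factor \<open>t\<close>, which is cancelled at the end.\<close>
    define \<psi> where "\<psi> x = sin (t * P (r n) x + a)" for x
    have el: "P (r n) \<in> elementary"
      unfolding P_def by (rule trig_poly_elementary[OF poly])
    have el': "(\<lambda>x. t * P (r n) x + a) \<in> elementary"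
      by (intro elementary.add elementary.mult elementary.const el)
    have "Z2_periodic (P (r n))"
      unfolding P_def hartley_sum_def by (rule trig_sum_periodic[OF A(2)])
    then have "Z2_periodic \<psi>" by (simp add: Z2_periodic_def \<psi>_def)
    then have test: "\<psi> \<in> test_functions"
      using elementary.sin[OF el'] by (intro elementary_test_function) (simp_all add: \<psi>_def[abs_def])
    have partial_P: "partial i (P (r n)) x = \<Gamma> i (r n) x" for i x
      unfolding P_def \<Gamma>_def by (rule partial_hartley_sum[OF G A(2,3)])
    have partial_\<psi>: "partial i \<psi> x = t * (b n x * \<Gamma> i (r n) x)" for i x
    proof -
      have "partial i (\<lambda>x. t * P (r n) x + a) x = t * partial i (P (r n)) x"
      proof -
        from has_derivative_partial[OF elementary_differentiable[OF el, of x]]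
        obtain D where D: "(P (r n) has_derivative D) (at x)" "D (axis i 1) = partial i (P (r n)) x"
          by auto
        have "((\<lambda>x. t * P (r n) x + a) has_derivative (\<lambda>h. t * D h)) (at x)"
          by (auto intro!: derivative_eq_intros D(1))
        from partial_eqI[OF this] D(2) show ?thesis by simp
      qed
      then show ?thesis
        unfolding \<psi>_def by (simp add: partial_sin[OF elementary_differentiable[OF el']] partial_P b_def)
    qed
    have "(\<integral>x. u x $ 1 * partial 1 \<psi> x + u x $ 2 * partial 2 \<psi> x \<partial>torus) = 0"
      using div test by (simp add: weakly_divergence_free_def)
    also have "(\<lambda>x. u x $ 1 * partial 1 \<psi> x + u x $ 2 * partial 2 \<psi> x) =
        (\<lambda>x. t * (u x $ 1 * (b n x * \<Gamma> 1 (r n) x) + u x $ 2 * (b n x * \<Gamma> 2 (r n) x)))"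
      unfolding partial_\<psi> by (simp only: distrib_left mult.left_commute)
    finally have "0 = (\<integral>x. t * (u x $ 1 * (b n x * \<Gamma> 1 (r n) x) + u x $ 2 * (b n x * \<Gamma> 2 (r n) x)) \<partial>torus)"
      by simp
    also have "\<dots> = t * ((\<integral>x. u x $ 1 * (b n x * \<Gamma> 1 (r n) x) \<partial>torus) + (\<integral>x. u x $ 2 * (b n x * \<Gamma> 2 (r n) x) \<partial>torus))"
      using int_b\<Gamma>[of 1 n "r n"] int_b\<Gamma>[of 2 n "r n"] by simp
    finally show ?thesis using t by simp
  qed
  have "(\<integral>x. u x $ 1 * G x $ 1 * \<beta> x \<partial>torus) + (\<integral>x. u x $ 2 * G x $ 2 * \<beta> x \<partial>torus) = 0"
    using tendsto_add[OF comp_lim[of 1] comp_lim[of 2]] by (simp add: zero LIMSEQ_const_iff)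
  moreover have "integrable torus (\<lambda>x. u x $ i * G x $ i * \<beta> x)" for i
    by (rule integrable_mult_bounded[OF int_uG meas_b(2), of 1]) (simp add: \<beta>_def)
  ultimately show ?thesis
    by (simp add: inner_vec_def sum_2 distrib_right \<beta>_def[symmetric])
qed

text \<open>Almost everywhere \<open>\<phi> - \<xi>\<close> is a multiple of the transport term, so
  it is orthogonal to all cosines of \<open>\<phi>\<close>, and these determine orthogonality to
  bounded Borel functions.\<close>

lemma strong_solution_orthogonal:
  assumes sol: "strong_solution \<tau> \<xi> \<phi>" and \<xi>: "\<xi> \<in> zero_mean_L2"
    and b: "b \<in> borel_measurable borel" "\<And>s. \<bar>b s\<bar> \<le> C"
  shows "(\<integral>x. (\<phi> x - \<xi> x) * b (\<phi> x) \<partial>torus) = 0"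
proof -
  obtain u G where bs: "is_biot_savart \<xi> u" and G: "has_weak_gradient \<phi> G"
    and eq: "AE x in torus. \<phi> x = \<xi> x - \<tau> * (u x \<bullet> G x)"
    using sol by (auto simp: strong_solution_def)
  \<comment> \<open>The weak gradient with components in L4; by uniqueness it may replace
    \<open>G\<close> in the equation.\<close>
  obtain H where H: "has_weak_gradient \<phi> H" "\<And>i. (\<lambda>x. H x $ i) \<in> Lp_space 4"
    using sol by (auto simp: strong_solution_def sobolev_W1_def)
  have u: "square_integrable torus (\<lambda>x. u x $ i)" for i
    using bs by (auto simp: is_biot_savart_def zero_mean_L2_def intro: Lp_space_2_square_integrable)
  have div: "weakly_divergence_free u" using bs by (simp add: is_biot_savart_def)
  have H2: "square_integrable torus (\<lambda>x. H x $ i)" for i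
    by (rule Lp_space_4_square_integrable[OF H(2)])
  have sq: "square_integrable torus \<phi>" "square_integrable torus \<xi>"
    and mean: "(\<integral>x. \<phi> x \<partial>torus) = 0" "(\<integral>x. \<xi> x \<partial>torus) = 0"
    using sol \<xi> by (auto simp: strong_solution_def zero_mean_L2_def intro: Lp_space_2_square_integrable)
  note int = square_integrable_imp_integrable[OF finite_measure_torus sq(1)]
    square_integrable_imp_integrable[OF finite_measure_torus sq(2)]
  have [measurable]: "\<phi> \<in> borel_measurable torus" "\<xi> \<in> borel_measurable torus"
    "(\<lambda>x. u x $ i) \<in> borel_measurable torus" "(\<lambda>x. H x $ i) \<in> borel_measurable torus" for i
    using sq u H2 by (auto simp: square_integrable_def)
  have [measurable]: "(\<lambda>x. u x \<bullet> H x) \<in> borel_measurable torus"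
    unfolding inner_vec_def sum_2 by simp
  have eq': "AE x in torus. \<phi> x - \<xi> x = - \<tau> * (u x \<bullet> H x)"
    using eq weak_gradient_unique[OF G H(1)] by eventually_elim simp
  have cos: "(\<integral>x. (\<phi> x - \<xi> x) * cos (t * \<phi> x + a) \<partial>torus) = 0" for t a
  proof (cases "t = 0")
    \<comment> \<open>For \<open>t = 0\<close> the cosine is constant, and the claim holds because
      both means are zero.\<close>
    case True
    then show ?thesis using int mean by simp
  next
    case False
    have "(\<integral>x. (\<phi> x - \<xi> x) * cos (t * \<phi> x + a) \<partial>torus) =
        (\<integral>x. - \<tau> * ((u x \<bullet> H x) * cos (t * \<phi> x + a)) \<partial>torus)"
    proof (rule integral_cong_AE)
      show "AE x in torus. (\<phi> x - \<xi> x) * cos (t * \<phi> x + a) = - \<tau> * ((u x \<bullet> H x) * cos (t * \<phi> x + a))"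
        using eq' by eventually_elim simp
    qed measurable
    also have "\<dots> = 0"
      using transport_orthogonal_cos[OF sq(1) H(1) H2 u div False] by simp
    finally show ?thesis .
  qed
  show ?thesis
    by (rule orthogonal_bounded_Borel_from_cos[OF _ _ cos b]) (use int in auto)
qed

section \<open>Comparison of the norms, for finite \<open>p\<close> and for
  \<open>p = \<infinity>\<close>\<close>

theorem lemma3p3:
  fixes p :: ennreal and \<xi> \<phi> :: "real^2 \<Rightarrow> real" and \<tau> :: real
  assumes "1 \<le> p"
    and "\<xi> \<in> Lp_space p \<inter> zero_mean_L2"
    and "\<tau> > 0"
    and "strong_solution \<tau> \<xi> \<phi>"
  shows "Lp_norm p \<phi> \<le> Lp_norm p \<xi>"
proof -
  have \<xi>: "\<xi> \<in> zero_mean_L2" using assms(2) by simp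
  have "\<phi> \<in> zero_mean_L2" using assms(4) by (simp add: strong_solution_def)
  with \<xi> have sq: "square_integrable torus \<phi>" "square_integrable torus \<xi>"
    by (auto simp: zero_mean_L2_def intro: Lp_space_2_square_integrable)
  note int = square_integrable_imp_integrable[OF finite_measure_torus sq(1)]
    square_integrable_imp_integrable[OF finite_measure_torus sq(2)]
  have orth: "(\<integral>x. (\<phi> x - \<xi> x) * b (\<phi> x) \<partial>torus) = 0"
    if "b \<in> borel_measurable borel" "\<And>s. \<bar>b s\<bar> \<le> (C::real)" for b C
    by (rule strong_solution_orthogonal[OF assms(4) \<xi> that])
  show ?thesis
  proof (cases "p = \<infinity>")
    case False
    define q where "q = enn2real p"
    have "1 \<le> q"
      using enn2real_mono[of 1 p] assms(1) False by (simp add: q_def less_top)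
    define I where "I f = (\<integral>\<^sup>+ x. ennreal (\<bar>f x\<bar> powr q) \<partial>torus)" for f
    have I: "I \<phi> \<le> I \<xi>"
      unfolding I_def
      by (rule martingale_nn_integral_powr_le[OF finite_measure_torus int \<open>1 \<le> q\<close>]) (rule orth)
    \<comment> \<open>The norm is a nondecreasing function of \<open>I f\<close>, the value
      \<open>\<infinity>\<close> included, so comparing the integrals is enough.\<close>
    have norm: "Lp_norm p f = (if I f = \<infinity> then \<infinity> else ennreal (enn2real (I f) powr (1 / q)))" for f
      using False by (simp add: Lp_norm_def I_def q_def Let_def)
    show ?thesis
    proof (cases "I \<xi> = \<infinity>")
      case fin: False
      then have "I \<xi> < top" by (simp add: less_top)
      then have "enn2real (I \<phi>) powr (1 / q) \<le> enn2real (I \<xi>) powr (1 / q)"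
        using \<open>1 \<le> q\<close> by (intro powr_mono2 enn2real_mono I) auto
      moreover have "I \<phi> \<noteq> \<infinity>" using I \<open>I \<xi> < top\<close> by auto
      ultimately show ?thesis using fin by (simp add: norm ennreal_leI)
    qed (simp add: norm)
  next
    case True
    define m where "m = Lp_norm p \<xi>"
    \<comment> \<open>Finiteness makes the passage through \<open>enn2real m\<close> lossless;
      \<open>enn2real\<close> would send \<open>\<infinity>\<close> to 0.\<close>
    have m: "m < \<infinity>" using assms(2) by (simp add: m_def Lp_space_def)
    have "AE x in torus. ennreal \<bar>\<xi> x\<bar> \<le> m"
      using esssup_AE[of "\<lambda>x. ennreal \<bar>\<xi> x\<bar>" torus] True by (simp add: m_def Lp_norm_def)
    then have "AE x in torus. \<bar>\<xi> x\<bar> \<le> enn2real m"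
    proof eventually_elim
      case (elim x)
      then show ?case using enn2real_mono[OF elim] m by simp
    qed
    then have "AE x in torus. \<bar>\<phi> x\<bar> \<le> enn2real m"
      by (rule martingale_AE_abs_le[OF int, rotated]) (rule orth)
    then have "AE x in torus. ennreal \<bar>\<phi> x\<bar> \<le> m"
    proof eventually_elim
      case (elim x)
      show ?case
        by (rule order_trans[OF ennreal_leI[OF elim]]) (use m in simp)
    qed
    then have "esssup torus (\<lambda>x. ennreal \<bar>\<phi> x\<bar>) \<le> m"
      using sq(1) by (intro esssup_I) (auto simp: square_integrable_def)
    then show ?thesis using True by (simp add: m_def Lp_norm_def)
  qed
qed

end
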